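(* There is a function $g\in L^2(\mathbb{R})$ such that $(g,1,1)=(E_mT_ng)_{m,n\in\mathbb{Z}}$ is a Weyl-Heisenberg frame for $L^2(\mathbb{R})$, and a function $f\in L^2(\mathbb{R})$, so that the WH-frame Identity fails for $f$ in the sense that the series on its right-hand side does not converge symmetrically; that is, $$\lim_{K\to\infty}\sum_{k=-K}^{K}\int_{\mathbb{R}}\overline{f(t)}f(t-k)G_k(t)\,dt$$ does not exist (as a finite number).
   Context: For $c\in\mathbb{R}$ let $T_cf(x)=f(x-c)$ and $E_cf(x)=e^{2\pi i c x}f(x)$. The system $(g,1,1)=(E_mT_ng)_{m,n\in\mathbb{Z}}$ is a Weyl-Heisenberg frame (WH-frame) if there are constants $A,B>0$ with $A\|f\|^2\le\sum_{m,n\in\mathbb{Z}}|\langle f,E_mT_ng\rangle|^2\le B\|f\|^2$ for all $f\in L^2(\mathbb{R})$. Put $G_k(t)=\sum_{n\in\mathbb{Z}}g(t-n)\overline{g(t-n-k)}$ for $k\in\mathbb{Z}$. The WH-frame Identity for $f$ (with parameters $a=b=1$) is $\sum_{m,n\in\mathbb{Z}}|\langle f,E_mT_ng\rangle|^2=\sum_{k\in\mathbb{Z}}\int_{\mathbb{R}}\overline{f(t)}f(t-k)G_k(t)\,dt$. *)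

theory Defs
  imports "HOL-Analysis.Analysis"
begin

text \<open>Elements of \<open>L\<^sup>2(\<real>)\<close> are represented by Borel measurable functions; every
  class of Lebesgue measurable functions modulo null sets contains such a representative,
  and all notions below depend only on the class.\<close>

definition L2 :: "(real \<Rightarrow> complex) set" where
  "L2 = {f. f \<in> borel_measurable lborel \<and> integrable lborel (\<lambda>x. (cmod (f x))\<^sup>2)}"

definition L2_inner :: "(real \<Rightarrow> complex) \<Rightarrow> (real \<Rightarrow> complex) \<Rightarrow> complex" where
  "L2_inner f g = (LINT x|lborel. f x * cnj (g x))"

definition L2_norm :: "(real \<Rightarrow> complex) \<Rightarrow> real" where
  "L2_norm f = sqrt (LINT x|lborel. (cmod (f x))\<^sup>2)"

definition translation :: "real \<Rightarrow> (real \<Rightarrow> complex) \<Rightarrow> real \<Rightarrow> complex" where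
  "translation c f = (\<lambda>x. f (x - c))"

definition modulation :: "real \<Rightarrow> (real \<Rightarrow> complex) \<Rightarrow> real \<Rightarrow> complex" where
  "modulation c f = (\<lambda>x. exp (2 * complex_of_real pi * \<i> * complex_of_real c * complex_of_real x) * f x)"

definition WH_coeff :: "(real \<Rightarrow> complex) \<Rightarrow> (real \<Rightarrow> complex) \<Rightarrow> int \<times> int \<Rightarrow> complex" where
  "WH_coeff g f = (\<lambda>(m, n). L2_inner f (modulation (of_int m) (translation (of_int n) g)))"

text \<open>The summability conjunct expresses that the double series is finite; without it the
  infinite sum would have the default value 0.\<close>

definition WH_frame :: "(real \<Rightarrow> complex) \<Rightarrow> bool" where
  "WH_frame g \<longleftrightarrow> (\<exists>A>0. \<exists>B>0. \<forall>f\<in>L2.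
     (\<lambda>p. (cmod (WH_coeff g f p))\<^sup>2) summable_on UNIV \<and>
     A * (L2_norm f)\<^sup>2 \<le> (\<Sum>\<^sub>\<infinity>p. (cmod (WH_coeff g f p))\<^sup>2) \<and>
     (\<Sum>\<^sub>\<infinity>p. (cmod (WH_coeff g f p))\<^sup>2) \<le> B * (L2_norm f)\<^sup>2)"

text \<open>For \<open>g\<close> in \<open>L\<^sup>2(\<real>)\<close> this series converges absolutely for almost every \<open>t\<close>;
  the default value 0 on the exceptional null set does not affect the integrals below.\<close>

definition WH_G :: "(real \<Rightarrow> complex) \<Rightarrow> int \<Rightarrow> real \<Rightarrow> complex" where
  "WH_G g k t = (\<Sum>\<^sub>\<infinity>n::int. g (t - of_int n) * cnj (g (t - of_int n - of_int k)))"

text \<open>If \<open>g\<close> generates a Weyl-Heisenberg frame with upper bound \<open>B\<close>, then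
  \<open>\<bar>WH_G g k t\<bar> \<le> B\<close> for almost every \<open>t\<close>, so the integrand is integrable
  for every \<open>f\<close> in \<open>L\<^sup>2(\<real>)\<close>.\<close>

definition WH_identity_term :: "(real \<Rightarrow> complex) \<Rightarrow> (real \<Rightarrow> complex) \<Rightarrow> int \<Rightarrow> complex" where
  "WH_identity_term g f k = (LINT t|lborel. cnj (f t) * f (t - of_int k) * WH_G g k t)"

end

theory Submission
  imports Defs
begin

text \<open>
  Write \<open>e(s)\<close> for \<open>exp (2 \<pi> \<i> s)\<close>. The Zak transform turns the system with parameters
  \<open>a = b = 1\<close> into a multiplication operator. For \<open>0 \<le> t < 1\<close> let \<open>Zg(t, \<xi>)\<close> be the sum of
  \<open>g(t + n) e(n \<xi>)\<close> over the integers \<open>n\<close>. The system is a frame if and only if \<open>|Zg|\<close> is bounded above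
  and away from 0, the functions \<open>G\<^sub>k(t)\<close> are the Fourier coefficients of \<open>|Zg(t, \<cdot>)|\<^sup>2\<close>, and the
  symmetric partial sum of order \<open>K\<close> on the right-hand side of the identity is the integral of
  \<open>|Zf|\<^sup>2 S\<^sub>K(|Zg|\<^sup>2)\<close> over the unit square, where \<open>S\<^sub>K\<close> is the \<open>K\<close>-th partial sum of a Fourier series.
  The identity must therefore fail for some \<open>f\<close> once \<open>|Zg|\<^sup>2\<close> is a bounded function whose Fourier partial
  sums are not uniformly bounded: this is the classical divergence phenomenon of du Bois-Reymond
  and Fejer.

  The dependence on \<open>t\<close> makes it possible to work with polynomials only. Cut the interval \<open>[0, 1)\<close> into
  countably many cells. If \<open>t\<close> is in a cell that carries the number \<open>N\<close>, then \<open>Zg(t, \<cdot>) = 1 + q\<^sub>N\<close>, where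
  \<open>q\<^sub>N(\<xi>)\<close> is the sum of \<open>e((4N - i) \<xi>) / (12 i)\<close> over \<open>0 < |i| \<le> N\<close>. Up to a unimodular factor, \<open>q\<^sub>N\<close> is
  one sixth of the sum of \<open>sin (2 \<pi> i \<xi>) / i\<close> over \<open>1 \<le> i \<le> N\<close>. These sums are bounded by 3
  (\<open>sum_sin_over_k_bounded\<close>), so \<open>|q\<^sub>N| \<le> 1/2\<close> and \<open>g\<close> generates a frame (\<open>WH_frame_cell_fun\<close>, which
  rests on Parseval's identity). In \<open>|1 + q\<^sub>N|\<^sup>2 = 1 + 2 Re q\<^sub>N + |q\<^sub>N|\<^sup>2\<close> the last term has
  frequencies of modulus at most \<open>2N\<close>, whereas those of \<open>q\<^sub>N\<close> lie between \<open>3N\<close> and \<open>5N\<close>. Hence passing from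
  the order \<open>3N - 1\<close> to the order \<open>4N\<close> adds, at the point \<open>\<xi> = 0\<close>, twice the sum of \<open>1 / (12 i)\<close> over \<open>1 \<le> i \<le> N\<close>,
  which grows like \<open>ln N\<close>; the negative coefficients of \<open>q\<^sub>N\<close> have frequencies above \<open>4N\<close>.

  On a cell with number \<open>N\<close> the test function \<open>f\<close> is a multiple of the indicator function of a block of \<open>8N + 1\<close>
  consecutive integers, so that \<open>|Zf|\<^sup>2\<close> is a Fejer kernel concentrated near \<open>\<xi> = 0\<close>. The resulting
  partial sums are unbounded (\<open>block_partial_sum_unbounded\<close>), and \<open>gliding_hump\<close>, a form of the uniform
  boundedness principle on the space of absolutely summable sequences, provides an assignment of numbers
  to cells and a distribution of the mass of \<open>f\<close> over the cells for which the partial sums of the whole series are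
  unbounded.
\<close>

section \<open>Characters and trigonometric polynomials on the unit interval\<close>

definition character :: "int \<Rightarrow> real \<Rightarrow> complex" where
  "character n t = cis (2 * pi * of_int n * t)"

abbreviation unit_cell :: "real measure" where
  "unit_cell \<equiv> restrict_space lborel {0..<1}"

lemma character_mult: "character m t * character n t = character (m + n) t"
  by (simp add: character_def cis_mult algebra_simps)

lemma character_0 [simp]: "character 0 t = 1"
  by (simp add: character_def)

lemma cnj_character [simp]: "cnj (character n t) = character (- n) t"
  by (simp add: character_def cis_cnj)

lemma cmod_character [simp]: "cmod (character n t) = 1"
  by (simp add: character_def)

lemma character_add_of_int: "character m (t + of_int l) = character m t"
proof -
  have "character m (t + of_int l) = character m t * cis (2 * pi * of_int (m * l))"
    by (simp add: character_def cis_mult algebra_simps)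
  also have "cis (2 * pi * of_int (m * l)) = 1" by (rule cis_multiple_2pi) simp
  finally show ?thesis by simp
qed

lemma continuous_on_character [continuous_intros]: "continuous_on A (character n)"
  unfolding character_def[abs_def] by (intro continuous_intros)

lemma borel_measurable_character [measurable]: "character n \<in> borel_measurable borel"
  by (intro borel_measurable_continuous_onI continuous_intros)

lemma borel_measurable_unit_cell:
  "h \<in> borel_measurable borel \<Longrightarrow> h \<in> borel_measurable unit_cell"
  by (rule measurable_restrict_space1) simp

lemma borel_measurable_character_unit_cell [measurable]: "character n \<in> borel_measurable unit_cell"
  by (intro borel_measurable_unit_cell borel_measurable_character)

lemma emeasure_unit_cell [simp]: "emeasure unit_cell {0..<1} = 1"
  by (simp add: emeasure_restrict_space)

lemma space_unit_cell [simp]: "space unit_cell = {0..<1}"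
  by (simp add: space_restrict_space)

lemma finite_measure_unit_cell: "finite_measure unit_cell"
  by (rule finite_measureI) simp

lemma integrable_character [simp]: "integrable unit_cell (character n)"
  by (rule finite_measure.integrable_const_bound[OF finite_measure_unit_cell, where B = 1]) auto

text \<open>For \<open>n \<noteq> 0\<close> the character has a periodic primitive.\<close>

lemma integral_character: "(LINT t|unit_cell. character n t) = of_bool (n = 0)"
proof (cases "n = 0")
  case True
  then show ?thesis by (simp add: measure_def)
next
  case False
  define c where "c = 2 * pi * real_of_int n"
  have c: "c \<noteq> 0" using False by (simp add: c_def)
  have "(LINT t|unit_cell. character n t) = (LINT t|lborel. indicator {0..<1} t *\<^sub>R character n t)"
    by (subst integral_restrict_space) auto
  also have "\<dots> = (LINT t|lborel. indicator {0..1} t *\<^sub>R character n t)"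
  proof (rule integral_cong_AE)
    have "AE t in lborel. t \<noteq> (1::real)" by (rule AE_lborel_singleton)
    then show "AE t in lborel. indicator {0..<1} t *\<^sub>R character n t = indicator {0..1} t *\<^sub>R character n t"
      by eventually_elim (auto split: split_indicator)
  qed auto
  also have "\<dots> = (\<lambda>t. cis (c * t) / (\<i> * of_real c)) 1 - (\<lambda>t. cis (c * t) / (\<i> * of_real c)) 0"
  proof (rule integral_FTC_atLeastAtMost)
    fix t :: real
    have "((\<lambda>z. exp (\<i> * of_real c * z) / (\<i> * of_real c)) has_field_derivative
        exp (\<i> * of_real c * of_real t)) (at (of_real t))"
      using c by (auto intro!: derivative_eq_intros)
    from has_vector_derivative_real_field[OF this]
    show "((\<lambda>t. cis (c * t) / (\<i> * of_real c)) has_vector_derivative character n t) (at t within {0..1})"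
      by (simp add: o_def cis_conv_exp character_def c_def algebra_simps)
  qed (auto intro!: continuous_intros)
  also have "cis (c * 1) = 1" unfolding c_def mult_1_right by (rule cis_multiple_2pi) simp
  finally show ?thesis using False by simp
qed

definition trig_poly :: "(real \<Rightarrow> complex) \<Rightarrow> bool" where
  "trig_poly p \<longleftrightarrow> (\<exists>F a. finite F \<and> p = (\<lambda>t. \<Sum>n\<in>F. a n * character n t))"

lemma trig_polyE:
  assumes "trig_poly p"
  obtains F a where "finite F" "p = (\<lambda>t. \<Sum>n\<in>F. a n * character n t)"
  using assms unfolding trig_poly_def by blast

lemma trig_poly_monomial: "trig_poly (\<lambda>t. c * character n t)"
  unfolding trig_poly_def by (intro exI[of _ "{n}"] exI[of _ "\<lambda>_. c"]) simp

lemma trig_poly_const: "trig_poly (\<lambda>t. c)"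
  using trig_poly_monomial[of c 0] by simp

lemma trig_poly_add:
  assumes "trig_poly p" "trig_poly q"
  shows "trig_poly (\<lambda>t. p t + q t)"
proof -
  obtain F a where F: "finite F" "p = (\<lambda>t. \<Sum>n\<in>F. a n * character n t)"
    using trig_polyE[OF assms(1)] .
  obtain G b where G: "finite G" "q = (\<lambda>t. \<Sum>n\<in>G. b n * character n t)"
    using trig_polyE[OF assms(2)] .
  let ?c = "\<lambda>n. (if n \<in> F then a n else 0) + (if n \<in> G then b n else 0)"
  have "p t + q t = (\<Sum>n\<in>F \<union> G. ?c n * character n t)" for t
  proof -
    have "p t = (\<Sum>n\<in>F \<union> G. (if n \<in> F then a n else 0) * character n t)"
      unfolding F(2) using F(1) G(1) by (intro sum.mono_neutral_cong_left) auto
    moreover have "q t = (\<Sum>n\<in>F \<union> G. (if n \<in> G then b n else 0) * character n t)"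
      unfolding G(2) using F(1) G(1) by (intro sum.mono_neutral_cong_left) auto
    ultimately show ?thesis by (simp add: distrib_right sum.distrib)
  qed
  then have "finite (F \<union> G) \<and> (\<lambda>t. p t + q t) = (\<lambda>t. \<Sum>n\<in>F \<union> G. ?c n * character n t)"
    using F(1) G(1) by simp
  then show ?thesis unfolding trig_poly_def by (intro exI[of _ "F \<union> G"] exI[of _ ?c])
qed

lemma trig_poly_sum:
  assumes "finite I" "\<And>i. i \<in> I \<Longrightarrow> trig_poly (p i)"
  shows "trig_poly (\<lambda>t. \<Sum>i\<in>I. p i t)"
  using assms
proof induction
  case empty
  then show ?case using trig_poly_const[of 0] by simp
next
  case (insert i I)
  then show ?case using trig_poly_add[of "p i" "\<lambda>t. \<Sum>i\<in>I. p i t"] by simp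
qed

lemma trig_poly_mult:
  assumes "trig_poly p" "trig_poly q"
  shows "trig_poly (\<lambda>t. p t * q t)"
proof -
  obtain F a where F: "finite F" "p = (\<lambda>t. \<Sum>n\<in>F. a n * character n t)"
    using trig_polyE[OF assms(1)] .
  obtain G b where G: "finite G" "q = (\<lambda>t. \<Sum>n\<in>G. b n * character n t)"
    using trig_polyE[OF assms(2)] .
  have "a n * character n t * (b m * character m t) = (a n * b m) * character (n + m) t" for n m t
    unfolding character_mult[symmetric] by (simp only: mult_ac)
  then have eq: "(\<lambda>t. p t * q t) = (\<lambda>t. \<Sum>n\<in>F. \<Sum>m\<in>G. (a n * b m) * character (n + m) t)"
    unfolding F(2) G(2) sum_product by (simp only:)
  show ?thesis unfolding eq by (rule trig_poly_sum[OF F(1)], rule trig_poly_sum[OF G(1)], rule trig_poly_monomial)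
qed

lemma trig_poly_borel_measurable:
  assumes "trig_poly p"
  shows "p \<in> borel_measurable borel"
  by (rule trig_polyE[OF assms]) simp

text \<open>Polynomials on the complex plane become trigonometric polynomials on the circle, since \<open>Re\<close> and \<open>Im\<close>
  are combinations of the characters of index 1 and -1. This connects trigonometric polynomials with
  the Stone-Weierstrass theorem.\<close>

lemma trig_poly_real_polynomial:
  assumes "real_polynomial_function f"
  shows "trig_poly (\<lambda>t. of_real (f (character 1 t)))"
  using assms
proof induction
  case (linear f)
  interpret f: bounded_linear f by fact
  have eq: "of_real (f (character 1 t))
      = (of_real (f 1) / 2 - \<i> * of_real (f \<i>) / 2) * character 1 t
      + (of_real (f 1) / 2 + \<i> * of_real (f \<i>) / 2) * character (- 1) t" for t
  proof -
    have "character 1 t = Re (character 1 t) *\<^sub>R 1 + Im (character 1 t) *\<^sub>R \<i>"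
      by (simp add: complex_eq_iff)
    then have "f (character 1 t) = f (Re (character 1 t) *\<^sub>R 1 + Im (character 1 t) *\<^sub>R \<i>)"
      by (rule arg_cong)
    also have "\<dots> = Re (character 1 t) * f 1 + Im (character 1 t) * f \<i>"
      by (simp only: f.add f.scaleR real_scaleR_def)
    finally show ?thesis by (simp add: complex_eq_iff character_def)
  qed
  show ?case unfolding eq by (intro trig_poly_add trig_poly_monomial)
next
  case (const c)
  then show ?case by (rule trig_poly_const)
next
  case (add f g)
  then show ?case unfolding of_real_add by (intro trig_poly_add)
next
  case (mult f g)
  then show ?case unfolding of_real_mult by (intro trig_poly_mult)
qed

section \<open>Density of trigonometric polynomials\<close>

text \<open>The closure of the trigonometric polynomials in \<open>L\<^sup>2\<close> of the unit interval. Distances are measured by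
  nonnegative integrals, so that no integrability has to be known in advance.\<close>

definition L2_approx :: "(real \<Rightarrow> complex) \<Rightarrow> bool" where
  "L2_approx f \<longleftrightarrow> f \<in> borel_measurable unit_cell \<and>
    (\<forall>\<epsilon>>0::real. \<exists>p. trig_poly p \<and> (\<integral>\<^sup>+t. ennreal ((cmod (f t - p t))\<^sup>2) \<partial>unit_cell) < ennreal \<epsilon>)"

text \<open>This replaces the triangle inequality of the \<open>L\<^sup>2\<close> norm wherever constants do not matter.\<close>

lemma cmod_add_power2_le: "(cmod (x + y))\<^sup>2 \<le> 2 * (cmod x)\<^sup>2 + 2 * (cmod y)\<^sup>2"
proof -
  have "(cmod (x + y))\<^sup>2 \<le> (cmod x + cmod y)\<^sup>2" by (intro power_mono norm_triangle_ineq) auto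
  also have "\<dots> \<le> 2 * (cmod x)\<^sup>2 + 2 * (cmod y)\<^sup>2"
    using zero_le_power2[of "cmod x - cmod y"] by (simp add: power2_eq_square algebra_simps)
  finally show ?thesis .
qed

lemma L2_approx_borel_measurable: "L2_approx f \<Longrightarrow> f \<in> borel_measurable unit_cell"
  unfolding L2_approx_def by (rule conjunct1)

lemma two_times_ennreal: "0 \<le> a \<Longrightarrow> 2 * ennreal a = ennreal (2 * a)"
  by (simp add: ennreal_mult')

lemma two_small_ennreal:
  assumes "a < ennreal (\<epsilon> / 8)" "b < ennreal (\<epsilon> / 8)" "0 < \<epsilon>"
  shows "2 * a + 2 * b < ennreal \<epsilon>"
proof -
  have "2 * a + 2 * b \<le> 2 * ennreal (\<epsilon> / 8) + 2 * ennreal (\<epsilon> / 8)"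
    using assms by (intro add_mono mult_left_mono) auto
  also have "\<dots> = ennreal (\<epsilon> / 2)"
    using assms by (simp add: two_times_ennreal ennreal_plus[symmetric] del: ennreal_plus)
  also have "\<dots> < ennreal \<epsilon>" using assms by (intro ennreal_lessI) auto
  finally show ?thesis .
qed

lemma L2_approxE:
  assumes "L2_approx f" "0 < \<epsilon>"
  obtains p where "trig_poly p"
    "(\<integral>\<^sup>+t. ennreal ((cmod (f t - p t))\<^sup>2) \<partial>unit_cell) < ennreal \<epsilon>"
    "p \<in> borel_measurable unit_cell"
proof -
  from assms(1)[unfolded L2_approx_def, THEN conjunct2, rule_format, OF assms(2)]
  obtain p where p: "trig_poly p" "(\<integral>\<^sup>+t. ennreal ((cmod (f t - p t))\<^sup>2) \<partial>unit_cell) < ennreal \<epsilon>"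
    by (elim exE conjE) (rule that)
  show ?thesis by (rule that[OF p borel_measurable_unit_cell[OF trig_poly_borel_measurable[OF p(1)]]])
qed

lemma nn_integral_cmod_add_power2_le:
  assumes [measurable]: "f \<in> borel_measurable M" "g \<in> borel_measurable M"
  shows "(\<integral>\<^sup>+t. ennreal ((cmod (f t + g t))\<^sup>2) \<partial>M)
    \<le> 2 * (\<integral>\<^sup>+t. ennreal ((cmod (f t))\<^sup>2) \<partial>M) + 2 * (\<integral>\<^sup>+t. ennreal ((cmod (g t))\<^sup>2) \<partial>M)"
proof -
  have "(\<integral>\<^sup>+t. ennreal ((cmod (f t + g t))\<^sup>2) \<partial>M)
      \<le> (\<integral>\<^sup>+t. 2 * ennreal ((cmod (f t))\<^sup>2) + 2 * ennreal ((cmod (g t))\<^sup>2) \<partial>M)"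
  proof (rule nn_integral_mono)
    fix t
    have "ennreal ((cmod (f t + g t))\<^sup>2) \<le> ennreal (2 * (cmod (f t))\<^sup>2 + 2 * (cmod (g t))\<^sup>2)"
      by (rule ennreal_leI[OF cmod_add_power2_le])
    then show "ennreal ((cmod (f t + g t))\<^sup>2) \<le> 2 * ennreal ((cmod (f t))\<^sup>2) + 2 * ennreal ((cmod (g t))\<^sup>2)"
      by (simp add: two_times_ennreal)
  qed
  also have "\<dots> = (\<integral>\<^sup>+t. 2 * ennreal ((cmod (f t))\<^sup>2) \<partial>M) + (\<integral>\<^sup>+t. 2 * ennreal ((cmod (g t))\<^sup>2) \<partial>M)"
    by (rule nn_integral_add) measurable
  also have "(\<integral>\<^sup>+t. 2 * ennreal ((cmod (f t))\<^sup>2) \<partial>M) = 2 * (\<integral>\<^sup>+t. ennreal ((cmod (f t))\<^sup>2) \<partial>M)"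
    by (rule nn_integral_cmult) measurable
  also have "(\<integral>\<^sup>+t. 2 * ennreal ((cmod (g t))\<^sup>2) \<partial>M) = 2 * (\<integral>\<^sup>+t. ennreal ((cmod (g t))\<^sup>2) \<partial>M)"
    by (rule nn_integral_cmult) measurable
  finally show ?thesis .
qed

lemma L2_approx_closed:
  assumes [measurable]: "f \<in> borel_measurable unit_cell"
    and "\<And>\<epsilon>::real. 0 < \<epsilon> \<Longrightarrow> \<exists>g. L2_approx g \<and> (\<integral>\<^sup>+t. ennreal ((cmod (f t - g t))\<^sup>2) \<partial>unit_cell) < ennreal \<epsilon>"
  shows "L2_approx f"
  unfolding L2_approx_def
proof (intro conjI allI impI)
  fix \<epsilon> :: real assume e: "0 < \<epsilon>"
  then have e8: "0 < \<epsilon> / 8" by simp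
  obtain g where g: "L2_approx g" "(\<integral>\<^sup>+t. ennreal ((cmod (f t - g t))\<^sup>2) \<partial>unit_cell) < ennreal (\<epsilon> / 8)"
    using assms(2)[OF e8] by (elim exE conjE) (rule that)
  have [measurable]: "g \<in> borel_measurable unit_cell" using g(1) by (rule L2_approx_borel_measurable)
  obtain p where p: "trig_poly p" "(\<integral>\<^sup>+t. ennreal ((cmod (g t - p t))\<^sup>2) \<partial>unit_cell) < ennreal (\<epsilon> / 8)"
    and [measurable]: "p \<in> borel_measurable unit_cell"
    by (rule L2_approxE[OF g(1) e8])
  have "(\<integral>\<^sup>+t. ennreal ((cmod (f t - p t))\<^sup>2) \<partial>unit_cell) = (\<integral>\<^sup>+t. ennreal ((cmod ((f t - g t) + (g t - p t)))\<^sup>2) \<partial>unit_cell)"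
    by simp
  also have "\<dots> \<le> 2 * (\<integral>\<^sup>+t. ennreal ((cmod (f t - g t))\<^sup>2) \<partial>unit_cell) + 2 * (\<integral>\<^sup>+t. ennreal ((cmod (g t - p t))\<^sup>2) \<partial>unit_cell)"
    by (rule nn_integral_cmod_add_power2_le) auto
  also have "\<dots> < ennreal \<epsilon>" by (rule two_small_ennreal[OF g(2) p(2) e])
  finally show "\<exists>p. trig_poly p \<and> (\<integral>\<^sup>+t. ennreal ((cmod (f t - p t))\<^sup>2) \<partial>unit_cell) < ennreal \<epsilon>"
    by (intro exI[of _ p] conjI p(1))
qed simp

lemma L2_approx_trig_poly: "trig_poly p \<Longrightarrow> L2_approx p"
  unfolding L2_approx_def
  by (intro conjI allI impI exI[of _ p] borel_measurable_unit_cell trig_poly_borel_measurable) simp_all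

lemma L2_approx_add:
  assumes "L2_approx f" "L2_approx g"
  shows "L2_approx (\<lambda>t. f t + g t)"
  unfolding L2_approx_def
proof (intro conjI allI impI)
  have [measurable]: "f \<in> borel_measurable unit_cell" "g \<in> borel_measurable unit_cell"
    using assms by (auto intro: L2_approx_borel_measurable)
  show "(\<lambda>t. f t + g t) \<in> borel_measurable unit_cell" by simp
  fix \<epsilon> :: real assume e: "0 < \<epsilon>"
  then have e8: "0 < \<epsilon> / 8" by simp
  obtain p where p: "trig_poly p" "(\<integral>\<^sup>+t. ennreal ((cmod (f t - p t))\<^sup>2) \<partial>unit_cell) < ennreal (\<epsilon> / 8)"
    and [measurable]: "p \<in> borel_measurable unit_cell"
    by (rule L2_approxE[OF assms(1) e8])
  obtain q where q: "trig_poly q" "(\<integral>\<^sup>+t. ennreal ((cmod (g t - q t))\<^sup>2) \<partial>unit_cell) < ennreal (\<epsilon> / 8)"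
    and [measurable]: "q \<in> borel_measurable unit_cell"
    by (rule L2_approxE[OF assms(2) e8])
  have "(\<integral>\<^sup>+t. ennreal ((cmod (f t + g t - (p t + q t)))\<^sup>2) \<partial>unit_cell)
      = (\<integral>\<^sup>+t. ennreal ((cmod ((f t - p t) + (g t - q t)))\<^sup>2) \<partial>unit_cell)"
    by (simp add: algebra_simps)
  also have "\<dots> \<le> 2 * (\<integral>\<^sup>+t. ennreal ((cmod (f t - p t))\<^sup>2) \<partial>unit_cell) + 2 * (\<integral>\<^sup>+t. ennreal ((cmod (g t - q t))\<^sup>2) \<partial>unit_cell)"
    by (rule nn_integral_cmod_add_power2_le) auto
  also have "\<dots> < ennreal \<epsilon>" by (rule two_small_ennreal[OF p(2) q(2) e])
  finally show "\<exists>p. trig_poly p \<and> (\<integral>\<^sup>+t. ennreal ((cmod (f t + g t - p t))\<^sup>2) \<partial>unit_cell) < ennreal \<epsilon>"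
    by (intro exI[of _ "\<lambda>t. p t + q t"] conjI trig_poly_add[OF p(1) q(1)])
qed

lemma L2_approx_scale:
  assumes "L2_approx f"
  shows "L2_approx (\<lambda>t. c * f t)"
  unfolding L2_approx_def
proof (intro conjI allI impI)
  have [measurable]: "f \<in> borel_measurable unit_cell"
    using assms by (auto intro: L2_approx_borel_measurable)
  show "(\<lambda>t. c * f t) \<in> borel_measurable unit_cell" by simp
  fix \<epsilon> :: real assume e: "0 < \<epsilon>"
  have pos: "0 < (cmod c)\<^sup>2 + 1" by (simp add: add_nonneg_pos)
  define \<delta> where "\<delta> = \<epsilon> / ((cmod c)\<^sup>2 + 1)"
  have d: "0 < \<delta>" using e pos by (simp add: \<delta>_def)
  obtain p where p: "trig_poly p" "(\<integral>\<^sup>+t. ennreal ((cmod (f t - p t))\<^sup>2) \<partial>unit_cell) < ennreal \<delta>"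
    and [measurable]: "p \<in> borel_measurable unit_cell"
    by (rule L2_approxE[OF assms d])
  have "(\<integral>\<^sup>+t. ennreal ((cmod (c * f t - c * p t))\<^sup>2) \<partial>unit_cell)
      = (\<integral>\<^sup>+t. ennreal ((cmod c)\<^sup>2) * ennreal ((cmod (f t - p t))\<^sup>2) \<partial>unit_cell)"
    by (simp add: right_diff_distrib[symmetric] norm_mult power_mult_distrib ennreal_mult)
  also have "\<dots> = ennreal ((cmod c)\<^sup>2) * (\<integral>\<^sup>+t. ennreal ((cmod (f t - p t))\<^sup>2) \<partial>unit_cell)"
    by (rule nn_integral_cmult) simp
  also have "\<dots> \<le> ennreal ((cmod c)\<^sup>2) * ennreal \<delta>" using p(2) by (intro mult_left_mono) auto
  also have "\<dots> = ennreal ((cmod c)\<^sup>2 * \<delta>)" using d by (simp add: ennreal_mult)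
  also have "\<dots> < ennreal \<epsilon>" using e pos by (intro ennreal_lessI) (auto simp: \<delta>_def field_simps)
  finally show "\<exists>p. trig_poly p \<and> (\<integral>\<^sup>+t. ennreal ((cmod (c * f t - p t))\<^sup>2) \<partial>unit_cell) < ennreal \<epsilon>"
    by (intro exI[of _ "\<lambda>t. c * p t"] conjI trig_poly_mult[OF trig_poly_const p(1)])
qed

lemma L2_approx_sum:
  assumes "finite I" "\<And>i. i \<in> I \<Longrightarrow> L2_approx (f i)"
  shows "L2_approx (\<lambda>t. \<Sum>i\<in>I. f i t)"
  using assms by induction (auto intro: L2_approx_add L2_approx_trig_poly[OF trig_poly_const])

lemma L2_approx_cong:
  assumes "L2_approx f" "\<And>t. t \<in> {0..<1} \<Longrightarrow> f t = g t"
  shows "L2_approx g"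
proof -
  have "g \<in> borel_measurable unit_cell"
    using L2_approx_borel_measurable[OF assms(1)] measurable_cong[of unit_cell f g borel] assms(2) by simp
  moreover have "(\<integral>\<^sup>+t. ennreal ((cmod (f t - p t))\<^sup>2) \<partial>unit_cell) = (\<integral>\<^sup>+t. ennreal ((cmod (g t - p t))\<^sup>2) \<partial>unit_cell)" for p
    using assms(2) by (intro nn_integral_cong) auto
  ultimately show ?thesis using assms(1) unfolding L2_approx_def by auto
qed

text \<open>Dominated convergence in \<open>L\<^sup>2\<close>: the differences are bounded by twice the dominating function.\<close>

lemma L2_approx_dominated:
  assumes lim: "\<And>t. t \<in> {0..<1} \<Longrightarrow> (\<lambda>i. s i t) \<longlonglongrightarrow> f t"
    and s: "\<And>i. L2_approx (s i)"
    and bound: "\<And>i t. t \<in> {0..<1} \<Longrightarrow> cmod (s i t) \<le> w t"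
    and w: "integrable unit_cell (\<lambda>t. (w t)\<^sup>2)"
  shows "L2_approx f"
proof (rule L2_approx_closed)
  have [measurable]: "s i \<in> borel_measurable unit_cell" for i using s by (rule L2_approx_borel_measurable)
  show f[measurable]: "f \<in> borel_measurable unit_cell"
    by (rule borel_measurable_LIMSEQ_metric[where f = s]) (use lim in auto)
  have bf: "cmod (f t) \<le> w t" if "t \<in> {0..<1}" for t
    by (rule Lim_bounded[OF tendsto_norm[OF lim[OF that]], of 0]) (use bound that in auto)
  have dom: "(cmod (f t - s i t))\<^sup>2 \<le> 4 * (w t)\<^sup>2" if "t \<in> {0..<1}" for t i
  proof -
    have "cmod (f t - s i t) \<le> w t + w t"
      using norm_triangle_ineq4[of "f t" "s i t"] bf[OF that] bound[OF that, of i] by linarith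
    then have "(cmod (f t - s i t))\<^sup>2 \<le> (w t + w t)\<^sup>2" by (intro power_mono) auto
    then show ?thesis by (simp add: power2_eq_square)
  qed
  have w4: "integrable unit_cell (\<lambda>t. 4 * (w t)\<^sup>2)" using w by simp
  have int: "integrable unit_cell (\<lambda>t. (cmod (f t - s i t))\<^sup>2)" for i
    by (rule Bochner_Integration.integrable_bound[OF w4]) (use dom in auto)
  have "(\<lambda>i. LINT t|unit_cell. (cmod (f t - s i t))\<^sup>2) \<longlonglongrightarrow> (LINT t|unit_cell. 0)"
  proof (rule integral_dominated_convergence[OF _ _ w4])
    show "AE t in unit_cell. (\<lambda>i. (cmod (f t - s i t))\<^sup>2) \<longlonglongrightarrow> 0"
    proof (rule AE_I2)
      fix t assume "t \<in> space unit_cell"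
      then have "(\<lambda>i. f t - s i t) \<longlonglongrightarrow> f t - f t" by (intro tendsto_diff lim tendsto_const) auto
      then have "(\<lambda>i. (cmod (f t - s i t))\<^sup>2) \<longlonglongrightarrow> (cmod (f t - f t))\<^sup>2" by (intro tendsto_power tendsto_norm)
      then show "(\<lambda>i. (cmod (f t - s i t))\<^sup>2) \<longlonglongrightarrow> 0" by simp
    qed
  qed (use dom in auto)
  then have L: "(\<lambda>i. LINT t|unit_cell. (cmod (f t - s i t))\<^sup>2) \<longlonglongrightarrow> 0" by simp
  fix \<epsilon> :: real assume e: "0 < \<epsilon>"
  then obtain i where i: "(LINT t|unit_cell. (cmod (f t - s i t))\<^sup>2) < \<epsilon>"
    using order_tendstoD(2)[OF L, of \<epsilon>] by (auto simp: eventually_sequentially)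
  have "(\<integral>\<^sup>+t. ennreal ((cmod (f t - s i t))\<^sup>2) \<partial>unit_cell) = ennreal (LINT t|unit_cell. (cmod (f t - s i t))\<^sup>2)"
    by (rule nn_integral_eq_integral[OF int]) auto
  also have "\<dots> < ennreal \<epsilon>" using i e by (intro ennreal_lessI) auto
  finally show "\<exists>g. L2_approx g \<and> (\<integral>\<^sup>+t. ennreal ((cmod (f t - g t))\<^sup>2) \<partial>unit_cell) < ennreal \<epsilon>"
    by (intro exI[of _ "s i"] conjI s)
qed

text \<open>The uniform approximation given by the Stone-Weierstrass theorem on the circle is also an approximation in \<open>L\<^sup>2\<close>,
  because the unit interval has measure 1.\<close>

lemma L2_approx_continuous_on_circle:
  fixes h :: "complex \<Rightarrow> real"
  assumes h: "continuous_on (sphere 0 1) h"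
  shows "L2_approx (\<lambda>t. of_real (h (character 1 t)))"
proof (rule L2_approx_closed)
  have "continuous_on UNIV (\<lambda>t. h (character 1 t))"
    by (rule continuous_on_compose2[OF h]) (auto intro!: continuous_intros)
  then have "(\<lambda>t. h (character 1 t)) \<in> borel_measurable unit_cell"
    by (intro borel_measurable_unit_cell borel_measurable_continuous_onI)
  then show "(\<lambda>t. complex_of_real (h (character 1 t))) \<in> borel_measurable unit_cell" by simp
  fix \<epsilon> :: real assume e: "0 < \<epsilon>"
  define \<delta> where "\<delta> = min 1 \<epsilon> / 2"
  have d: "0 < \<delta>" "\<delta> < 1" "\<delta> < \<epsilon>" using e by (auto simp: \<delta>_def min_def)
  obtain p where p: "polynomial_function p" "\<And>z. z \<in> sphere 0 1 \<Longrightarrow> norm (h z - p z) < \<delta>"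
    using Stone_Weierstrass_polynomial_function[OF compact_sphere h d(1)] by blast
  have rp: "real_polynomial_function p" using p(1) by (simp add: real_polynomial_function_eq)
  let ?g = "\<lambda>t. complex_of_real (p (character 1 t))"
  have "(\<integral>\<^sup>+t. ennreal ((cmod (of_real (h (character 1 t)) - ?g t))\<^sup>2) \<partial>unit_cell) \<le> (\<integral>\<^sup>+t. ennreal \<delta> \<partial>unit_cell)"
  proof (intro nn_integral_mono ennreal_leI)
    fix t
    have "\<bar>h (character 1 t) - p (character 1 t)\<bar> \<le> \<delta>" using p(2)[of "character 1 t"] by simp
    then have "(cmod (of_real (h (character 1 t) - p (character 1 t))))\<^sup>2 \<le> \<delta>\<^sup>2"
      unfolding norm_of_real by (intro power_mono) auto
    also have "\<dots> \<le> \<delta>" using d by (simp add: power2_eq_square mult_le_one)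
    finally show "(cmod (of_real (h (character 1 t)) - ?g t))\<^sup>2 \<le> \<delta>" by simp
  qed
  also have "\<dots> = ennreal \<delta>" by simp
  also have "\<dots> < ennreal \<epsilon>" using d by (intro ennreal_lessI) auto
  finally show "\<exists>g. L2_approx g \<and> (\<integral>\<^sup>+t. ennreal ((cmod (of_real (h (character 1 t)) - g t))\<^sup>2) \<partial>unit_cell) < ennreal \<epsilon>"
    by (intro exI[of _ ?g] conjI L2_approx_trig_poly[OF trig_poly_real_polynomial[OF rp]])
qed

text \<open>The circle is parametrized injectively; hence an interval \<open>[0, a]\<close> is the preimage of a compact subset
  of the circle, and its indicator function can be approximated by continuous functions on the circle.\<close>

lemma character_1_inj_on: "inj_on (character 1) {0..<1}"
proof (rule inj_onI)
  fix s t :: real assume st: "s \<in> {0..<1}" "t \<in> {0..<1}" "character 1 s = character 1 t"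
  have "exp (\<i> * of_real (2 * pi * s)) = exp (\<i> * of_real (2 * pi * t))"
    using st(3) by (simp add: character_def cis_conv_exp)
  then obtain n :: int where "\<i> * of_real (2 * pi * s) = \<i> * of_real (2 * pi * t) + (of_int (2 * n) * pi) * \<i>"
    unfolding exp_eq by blast
  then have "Im (\<i> * of_real (2 * pi * s)) = Im (\<i> * of_real (2 * pi * t) + (of_int (2 * n) * pi) * \<i>)"
    by simp
  then have "2 * pi * s = 2 * pi * (t + of_int n)" by (simp add: algebra_simps)
  then have "s = t + of_int n" by simp
  moreover have "-1 < s - t" "s - t < 1" using st by auto
  ultimately have "-1 < real_of_int n" "real_of_int n < 1" by linarith+
  then have "n = 0" by linarith
  then show "s = t" using \<open>s = t + of_int n\<close> by simp
qed

text \<open>The interval \<open>[0, a]\<close> corresponds to a compact arc, whose indicator function is the limit of the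
  continuous functions \<open>max 0 (1 - i d)\<close>, where \<open>d\<close> is the distance to the arc.\<close>

lemma L2_approx_indicator_atMost: "L2_approx (indicator {..a})"
proof -
  consider "a < 0" | "0 \<le> a" "a < 1" | "1 \<le> a" by linarith
  then show ?thesis
  proof cases
    case 1
    show ?thesis by (rule L2_approx_cong[OF L2_approx_trig_poly[OF trig_poly_const[of 0]]]) (use 1 in auto)
  next
    case 3
    show ?thesis by (rule L2_approx_cong[OF L2_approx_trig_poly[OF trig_poly_const[of 1]]]) (use 3 in auto)
  next
    case 2
    define C where "C = character 1 ` {0..a}"
    have "compact C" unfolding C_def by (intro compact_continuous_image continuous_intros) auto
    then have C: "closed C" "C \<noteq> {}" using 2 by (auto simp: C_def compact_imp_closed)
    define h where "h i z = max 0 (1 - real i * infdist z C)" for i z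
    show ?thesis
    proof (rule L2_approx_dominated[where w = "\<lambda>_. 1" and s = "\<lambda>i t. of_real (h i (character 1 t))"])
      show "L2_approx (\<lambda>t. of_real (h i (character 1 t)))" for i
        unfolding h_def by (intro L2_approx_continuous_on_circle continuous_intros)
      show "cmod (of_real (h i (character 1 t))) \<le> 1" for i t
        by (simp add: h_def infdist_nonneg)
      show "integrable unit_cell (\<lambda>t. 1\<^sup>2)"
        unfolding power_one by (rule finite_measure.integrable_const[OF finite_measure_unit_cell])
      fix t :: real assume t: "t \<in> {0..<1}"
      have mem: "character 1 t \<in> C \<longleftrightarrow> t \<le> a"
      proof -
        have "{0..a} \<subseteq> {0..<1}" using 2 by auto
        from inj_on_image_mem_iff[OF character_1_inj_on t this] show ?thesis unfolding C_def using t by simp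
      qed
      have "(\<lambda>i. h i (character 1 t)) \<longlonglongrightarrow> indicator {..a} t"
      proof (cases "t \<le> a")
        case True
        then have "infdist (character 1 t) C = 0" using mem in_closed_iff_infdist_zero[OF C] by simp
        then show ?thesis using True by (simp add: h_def)
      next
        case False
        define d where "d = infdist (character 1 t) C"
        have "0 < d" using False mem in_closed_iff_infdist_zero[OF C] infdist_nonneg[of _ C]
          by (auto simp: d_def less_le)
        then obtain i0 where i0: "1 < real i0 * d" using reals_Archimedean3 by blast
        have "h i (character 1 t) = 0" if "i0 \<le> i" for i
        proof -
          have "real i0 * d \<le> real i * d" using that \<open>0 < d\<close> by simp
          then show ?thesis using i0 by (simp add: h_def d_def)
        qed
        then have "eventually (\<lambda>i. h i (character 1 t) = 0) sequentially"
          unfolding eventually_sequentially by blast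
        then show ?thesis using False by (simp add: tendsto_eventually)
      qed
      then have "(\<lambda>i. complex_of_real (h i (character 1 t))) \<longlonglongrightarrow> of_real (indicator {..a} t)"
        by (rule tendsto_of_real)
      then show "(\<lambda>i. complex_of_real (h i (character 1 t))) \<longlonglongrightarrow> indicator {..a} t"
        by (cases "t \<le> a") simp_all
    qed
  qed
qed

text \<open>The half-lines form a generator of the Borel sets that is closed under intersection, and the sets with
  approximable indicator function form a Dynkin system.\<close>

lemma L2_approx_indicator:
  assumes "A \<in> sets borel"
  shows "L2_approx (indicator A)"
proof -
  let ?G = "range (\<lambda>a::real. {..a})"
  have borel: "sigma_sets UNIV ?G = sets borel"
    by (subst borel_eq_atMost) simp
  have stable: "Int_stable ?G"
  proof (rule Int_stableI)
    fix a b :: "real set" assume "a \<in> ?G" "b \<in> ?G"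
    then obtain x y where "a = {..x}" "b = {..y}" by blast
    then have "a \<inter> b = {..min x y}" by auto
    then show "a \<inter> b \<in> ?G" by blast
  qed
  have "A \<in> sigma_sets UNIV ?G" using assms borel by simp
  show ?thesis
    using stable subset_UNIV[of ?G, folded Pow_UNIV] \<open>A \<in> sigma_sets UNIV ?G\<close>
  proof (induction rule: sigma_sets_induct_disjoint)
    case (basic A)
    then show ?case using L2_approx_indicator_atMost by blast
  next
    case empty
    show ?case by (rule L2_approx_cong[OF L2_approx_trig_poly[OF trig_poly_const[of 0]]]) auto
  next
    case (compl A)
    have "L2_approx (\<lambda>t. 1 + (- 1) * indicator A t)"
      using compl by (intro L2_approx_add L2_approx_scale L2_approx_trig_poly[OF trig_poly_const])
    then show ?case by (rule L2_approx_cong) (auto simp: indicator_def)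
  next
    case (union A)
    show ?case
    proof (rule L2_approx_dominated[where w = "\<lambda>_. 1" and s = "\<lambda>n. indicator (\<Union>i<n. A i)"])
      have eq: "indicator (\<Union>i<n. A i) = (\<lambda>t. \<Sum>i<n. indicator (A i) t :: complex)" for n
        using union(1) by (intro ext indicator_UN_disjoint) (auto simp: disjoint_family_on_def)
      show "L2_approx (indicator (\<Union>i<n. A i))" for n
        unfolding eq using union by (intro L2_approx_sum) auto
      show "cmod (indicator (\<Union>i<n. A i) t) \<le> 1" for n t by (simp add: indicator_def)
      show "integrable unit_cell (\<lambda>t. 1\<^sup>2)"
        unfolding power_one by (rule finite_measure.integrable_const[OF finite_measure_unit_cell])
      show "(\<lambda>n. indicator (\<Union>i<n. A i) t :: complex) \<longlonglongrightarrow> indicator (\<Union>i. A i) t" for t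
        by (rule LIMSEQ_indicator_UN)
    qed
  qed
qed

text \<open>Every measurable function is a pointwise limit of simple functions of at most twice its modulus, and these are
  finite sums of indicator functions.\<close>

lemma L2_approx_square_integrable:
  assumes [measurable]: "f \<in> borel_measurable unit_cell"
    and f2: "integrable unit_cell (\<lambda>t. (cmod (f t))\<^sup>2)"
  shows "L2_approx f"
proof -
  obtain s where "\<forall>i. simple_function unit_cell (s i)"
    "\<forall>t\<in>space unit_cell. (\<lambda>i. s i t) \<longlonglongrightarrow> f t"
    "\<forall>i. \<forall>t\<in>space unit_cell. dist (s i t) 0 \<le> 2 * dist (f t) 0"
    using borel_measurable_implies_sequence_metric[OF assms(1), of 0] by (elim exE conjE) (rule that)
  then have s: "\<And>i. simple_function unit_cell (s i)"
    and lim: "\<And>t. t \<in> {0..<1} \<Longrightarrow> (\<lambda>i. s i t) \<longlonglongrightarrow> f t"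
    and bound: "\<And>i t. t \<in> {0..<1} \<Longrightarrow> cmod (s i t) \<le> 2 * cmod (f t)" by auto
  show ?thesis
  proof (rule L2_approx_dominated[OF lim _ bound])
    have "integrable unit_cell (\<lambda>t. 4 * (cmod (f t))\<^sup>2)" using f2 by simp
    then show "integrable unit_cell (\<lambda>t. (2 * cmod (f t))\<^sup>2)" by (simp add: power_mult_distrib)
    fix i
    have "L2_approx (\<lambda>t. \<Sum>y\<in>s i ` {0..<1}. y * indicator (s i -` {y} \<inter> {0..<1}) t)"
    proof (intro L2_approx_sum L2_approx_scale L2_approx_indicator)
      show "finite (s i ` {0..<1})" using simple_functionD(1)[OF s[of i]] by simp
      show "s i -` {y} \<inter> {0..<1} \<in> sets borel" for y
        using simple_functionD(2)[OF s[of i], of "{y}"] by (auto simp: sets_restrict_space_iff)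
    qed
    moreover have "(\<Sum>y\<in>s i ` {0..<1}. y * indicator (s i -` {y} \<inter> {0..<1}) t) = s i t" if "t \<in> {0..<1}" for t
    proof -
      have "s i t = (\<Sum>y\<in>s i ` {0..<1}. indicator (s i -` {y} \<inter> {0..<1}) t *\<^sub>R y)"
        using simple_function_indicator_representation_banach[OF s[of i], of t] that
        by (simp only: space_unit_cell)
      also have "\<dots> = (\<Sum>y\<in>s i ` {0..<1}. y * indicator (s i -` {y} \<inter> {0..<1}) t)"
        by (intro sum.cong refl) (simp split: split_indicator)
      finally show ?thesis by (rule sym)
    qed
    ultimately show "L2_approx (s i)" by (rule L2_approx_cong)
  qed
qed

section \<open>Parseval's identity\<close>

text \<open>This lemma and its converse pass between sums over the integers, for which the frame condition is
  stated, and integrals over a counting measure, to which Tonelli's theorem applies.\<close>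

lemma nn_integral_count_space_has_sum:
  fixes h :: "'a \<Rightarrow> real"
  assumes "(h has_sum r) UNIV" "\<And>x. 0 \<le> h x"
  shows "(\<integral>\<^sup>+x. ennreal (h x) \<partial>count_space UNIV) = ennreal r"
proof -
  have "(\<lambda>x. norm (h x)) summable_on UNIV" using assms by (auto simp: has_sum_imp_summable)
  then have abs: "Infinite_Set_Sum.abs_summable_on h UNIV" by (simp only: abs_summable_equivalent)
  show ?thesis
    using nn_integral_conv_infsetsum[OF abs] infsetsum_infsum[OF abs] infsumI[OF assms(1)] assms(2) by simp
qed

lemma has_sum_nn_integral_count_space:
  fixes h :: "'a \<Rightarrow> real"
  assumes "(\<integral>\<^sup>+x. ennreal (h x) \<partial>count_space UNIV) = ennreal r" "0 \<le> r" "\<And>x. 0 \<le> h x"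
  shows "(h has_sum r) UNIV"
proof -
  have "integrable (count_space UNIV) h"
    using assms by (intro integrableI_bounded) auto
  then have abs: "Infinite_Set_Sum.abs_summable_on h UNIV" by (simp only: Infinite_Set_Sum.abs_summable_on_def)
  then have "(\<lambda>x. norm (h x)) summable_on UNIV" by (simp only: abs_summable_equivalent)
  then have sum: "h summable_on UNIV" using assms(3) by simp
  have "ennreal (infsetsum h UNIV) = ennreal r"
    using nn_integral_conv_infsetsum[OF abs] assms(1,3) by simp
  moreover have "0 \<le> infsetsum h UNIV" using assms(3) by (intro infsetsum_nonneg) auto
  ultimately have "infsum h UNIV = r" using infsetsum_infsum[OF abs] assms(2) by simp
  then show ?thesis using has_sum_infsum[OF sum] by simp
qed

lemma nn_integral_count_space_le_finite_sums:
  fixes h :: "'a \<Rightarrow> real"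
  assumes nonneg: "\<And>x. 0 \<le> h x"
    and le: "\<And>F. finite F \<Longrightarrow> (\<Sum>x\<in>F. ennreal (h x)) \<le> C"
  shows "(\<integral>\<^sup>+x. ennreal (h x) \<partial>count_space UNIV) \<le> C"
proof (cases C)
  case top
  then show ?thesis by simp
next
  case (real r)
  have sums: "sum h F \<le> r" if "finite F" for F
    using le[OF that] real nonneg by (simp add: sum_nonneg)
  have s: "h summable_on UNIV"
    using sums nonneg by (intro nonneg_bdd_above_summable_on) (auto intro!: bdd_aboveI[of _ r])
  have "(\<integral>\<^sup>+x. ennreal (h x) \<partial>count_space UNIV) = ennreal (infsum h UNIV)"
    by (rule nn_integral_count_space_has_sum[OF has_sum_infsum[OF s] nonneg])
  also have "\<dots> \<le> ennreal r" using s sums by (intro ennreal_leI infsum_le_finite_sums) auto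
  finally show ?thesis using real by simp
qed

definition fourier_coeff :: "(real \<Rightarrow> complex) \<Rightarrow> int \<Rightarrow> complex" where
  "fourier_coeff f m = (LINT t|unit_cell. f t * character (- m) t)"

lemma square_integrable_imp_integrable:
  assumes "finite_measure M" and [measurable]: "f \<in> borel_measurable M"
    and "integrable M (\<lambda>t. (cmod (f t))\<^sup>2)"
  shows "integrable M f"
proof (rule Bochner_Integration.integrable_bound)
  show "integrable M (\<lambda>t. 1 + (cmod (f t))\<^sup>2)"
    using assms finite_measure.integrable_const[OF assms(1)] by (intro Bochner_Integration.integrable_add)
  have "cmod z \<le> 1 + (cmod z)\<^sup>2" for z
  proof -
    have "2 * cmod z \<le> 1 + (cmod z)\<^sup>2"
      using zero_le_power2[of "cmod z - 1"] by (simp add: power2_eq_square algebra_simps)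
    then show ?thesis using norm_ge_zero[of z] by linarith
  qed
  then show "AE t in M. norm (f t) \<le> norm (1 + (cmod (f t))\<^sup>2)" by simp
qed simp

text \<open>Expanding the square and using orthonormality of the characters gives the distance of \<open>f\<close> to any trigonometric
  polynomial with frequencies in \<open>F\<close>. The choice \<open>b = fourier_coeff f\<close> is optimal and yields Bessel's
  inequality; the choice \<open>f = 0\<close> yields the norm of a trigonometric polynomial.\<close>

lemma integral_distance_trig_poly:
  assumes [measurable]: "f \<in> borel_measurable unit_cell"
    and f2: "integrable unit_cell (\<lambda>t. (cmod (f t))\<^sup>2)"
    and F: "finite F"
  shows "(LINT t|unit_cell. (cmod (f t - (\<Sum>m\<in>F. b m * character m t)))\<^sup>2)
    = (LINT t|unit_cell. (cmod (f t))\<^sup>2) - (\<Sum>m\<in>F. (cmod (fourier_coeff f m))\<^sup>2)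
      + (\<Sum>m\<in>F. (cmod (fourier_coeff f m - b m))\<^sup>2)"
proof -
  define c where "c = fourier_coeff f"
  have f: "integrable unit_cell f"
    by (rule square_integrable_imp_integrable[OF finite_measure_unit_cell]) fact+
  have "cnj \<in> borel_measurable borel" by (intro borel_measurable_continuous_onI continuous_intros)
  then have [measurable]: "(\<lambda>t. cnj (f t)) \<in> borel_measurable unit_cell"
    by (rule measurable_compose[OF assms(1)])
  have fc [simp]: "integrable unit_cell (\<lambda>t. f t * character m t)" for m
    by (rule Bochner_Integration.integrable_bound[OF f]) (auto simp: norm_mult)
  have fc' [simp]: "integrable unit_cell (\<lambda>t. cnj (f t) * character m t)" for m
    by (rule Bochner_Integration.integrable_bound[OF f]) (auto simp: norm_mult)
  have cI: "(LINT t|unit_cell. f t * character (- m) t) = c m" for m by (simp add: c_def fourier_coeff_def)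
  have cI': "(LINT t|unit_cell. cnj (f t) * character m t) = cnj (c m)" for m
  proof -
    have "cnj (c m) = (LINT t|unit_cell. cnj (f t * character (- m) t))"
      unfolding cI[symmetric] by (rule Bochner_Integration.integral_cnj[symmetric])
    then show ?thesis by (simp only: complex_cnj_mult cnj_character minus_minus)
  qed
  have f2c: "integrable unit_cell (\<lambda>t. complex_of_real ((cmod (f t))\<^sup>2))"
    using f2 by (rule integrable_of_real)
  have h: "has_bochner_integral unit_cell (\<lambda>t. complex_of_real ((cmod (f t))\<^sup>2)) (complex_of_real (LINT t|unit_cell. (cmod (f t))\<^sup>2))"
    "has_bochner_integral unit_cell (\<lambda>t. f t * character (- m) t) (c m)"
    "has_bochner_integral unit_cell (\<lambda>t. cnj (f t) * character m t) (cnj (c m))"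
    "has_bochner_integral unit_cell (\<lambda>t. character m t) (of_bool (m = 0))" for m
    unfolding has_bochner_integral_iff using f2c cI cI'
    by (simp_all add: integral_character integral_complex_of_real[where f = "\<lambda>t. (cmod (f t))\<^sup>2"] del: of_real_power)
  have pw: "complex_of_real ((cmod (f t - (\<Sum>m\<in>F. b m * character m t)))\<^sup>2)
     = complex_of_real ((cmod (f t))\<^sup>2) - (\<Sum>m\<in>F. cnj (b m) * (f t * character (- m) t))
       - (\<Sum>m\<in>F. b m * (cnj (f t) * character m t))
       + (\<Sum>m\<in>F. \<Sum>n\<in>F. (b m * cnj (b n)) * character (m - n) t)" for t
  proof -
    have "(\<Sum>m\<in>F. b m * character m t) * cnj (\<Sum>m\<in>F. b m * character m t)
        = (\<Sum>m\<in>F. \<Sum>n\<in>F. (b m * cnj (b n)) * character (m - n) t)"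
      unfolding cnj_sum sum_product
    proof (intro sum.cong refl)
      fix m n
      have "character (m - n) t = character m t * character (- n) t" by (simp add: character_mult)
      then show "b m * character m t * cnj (b n * character n t) = b m * cnj (b n) * character (m - n) t"
        by simp
    qed
    moreover have "f t * cnj (\<Sum>m\<in>F. b m * character m t) = (\<Sum>m\<in>F. cnj (b m) * (f t * character (- m) t))"
      by (simp add: cnj_sum sum_distrib_left mult_ac)
    moreover have "(\<Sum>m\<in>F. b m * character m t) * cnj (f t) = (\<Sum>m\<in>F. b m * (cnj (f t) * character m t))"
      unfolding sum_distrib_right by (intro sum.cong refl) (simp only: mult_ac)
    ultimately show ?thesis
      by (simp only: complex_norm_square complex_cnj_diff left_diff_distrib right_diff_distrib) simp
  qed
  have "complex_of_real (LINT t|unit_cell. (cmod (f t - (\<Sum>m\<in>F. b m * character m t)))\<^sup>2)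
     = (LINT t|unit_cell. complex_of_real ((cmod (f t - (\<Sum>m\<in>F. b m * character m t)))\<^sup>2))"
    by (rule integral_complex_of_real[symmetric])
  also have "\<dots> = complex_of_real (LINT t|unit_cell. (cmod (f t))\<^sup>2) - (\<Sum>m\<in>F. cnj (b m) * c m)
       - (\<Sum>m\<in>F. b m * cnj (c m)) + (\<Sum>m\<in>F. \<Sum>n\<in>F. (b m * cnj (b n)) * of_bool (m - n = 0))"
    unfolding pw
    by (intro has_bochner_integral_integral_eq has_bochner_integral_add has_bochner_integral_diff
        has_bochner_integral_sum has_bochner_integral_mult_right h)
  also have "(\<Sum>m\<in>F. \<Sum>n\<in>F. (b m * cnj (b n)) * of_bool (m - n = 0)) = (\<Sum>m\<in>F. b m * cnj (b m))"
    using F by (intro sum.cong refl) (simp add: of_bool_def if_distrib cong: if_cong)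
  also have "complex_of_real (LINT t|unit_cell. (cmod (f t))\<^sup>2) - (\<Sum>m\<in>F. cnj (b m) * c m)
       - (\<Sum>m\<in>F. b m * cnj (c m)) + (\<Sum>m\<in>F. b m * cnj (b m))
      = complex_of_real (LINT t|unit_cell. (cmod (f t))\<^sup>2) - (\<Sum>m\<in>F. c m * cnj (c m))
        + (\<Sum>m\<in>F. (c m - b m) * cnj (c m - b m))"
    by (simp add: algebra_simps sum.distrib sum_subtractf)
  also have "\<dots> = complex_of_real ((LINT t|unit_cell. (cmod (f t))\<^sup>2) - (\<Sum>m\<in>F. (cmod (c m))\<^sup>2)
        + (\<Sum>m\<in>F. (cmod (c m - b m))\<^sup>2))"
    by (simp only: complex_norm_square[symmetric] of_real_add of_real_diff of_real_sum)
  finally show ?thesis unfolding c_def of_real_eq_iff .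
qed

text \<open>The defect in Bessel's inequality for \<open>F\<close> is at most the squared distance from \<open>f\<close> to any trigonometric polynomial with
  frequencies in \<open>F\<close>, and by density this distance can be made arbitrarily small.\<close>

lemma parseval:
  assumes [measurable]: "f \<in> borel_measurable unit_cell"
    and f2: "integrable unit_cell (\<lambda>t. (cmod (f t))\<^sup>2)"
  shows "((\<lambda>m. (cmod (fourier_coeff f m))\<^sup>2) has_sum (LINT t|unit_cell. (cmod (f t))\<^sup>2)) UNIV"
proof -
  define I where "I = (LINT t|unit_cell. (cmod (f t))\<^sup>2)"
  define S where "S F = (\<Sum>m\<in>F. (cmod (fourier_coeff f m))\<^sup>2)" for F
  have bessel: "I - S F \<ge> 0" if "finite F" for F
  proof -
    have "0 \<le> (LINT t|unit_cell. (cmod (f t - (\<Sum>m\<in>F. fourier_coeff f m * character m t)))\<^sup>2)"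
      by (intro Bochner_Integration.integral_nonneg) auto
    also have "\<dots> = I - S F"
      by (simp add: integral_distance_trig_poly[OF assms that] I_def S_def)
    finally show ?thesis .
  qed
  have "\<forall>\<^sub>F F in finite_subsets_at_top UNIV. dist (S F) I < \<epsilon>" if e: "0 < \<epsilon>" for \<epsilon>
  proof -
    obtain p where p: "trig_poly p" "(\<integral>\<^sup>+t. ennreal ((cmod (f t - p t))\<^sup>2) \<partial>unit_cell) < ennreal \<epsilon>"
      and [measurable]: "p \<in> borel_measurable unit_cell"
      by (rule L2_approxE[OF L2_approx_square_integrable[OF assms] e])
    obtain G b where G: "finite G" "p = (\<lambda>t. \<Sum>n\<in>G. b n * character n t)"
      using trig_polyE[OF p(1)] .
    have int: "integrable unit_cell (\<lambda>t. (cmod (f t - p t))\<^sup>2)"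
    proof (rule integrableI_bounded)
      show "(\<integral>\<^sup>+t. ennreal (norm ((cmod (f t - p t))\<^sup>2)) \<partial>unit_cell) < \<infinity>"
        using p(2) by (auto intro: less_trans)
    qed simp
    have "ennreal (LINT t|unit_cell. (cmod (f t - p t))\<^sup>2) < ennreal \<epsilon>"
      using p(2) nn_integral_eq_integral[OF int] by simp
    then have small: "(LINT t|unit_cell. (cmod (f t - p t))\<^sup>2) < \<epsilon>"
      using e by (subst (asm) ennreal_less_iff) (auto intro!: Bochner_Integration.integral_nonneg)
    have "dist (S F) I < \<epsilon>" if F: "finite F" "G \<subseteq> F" for F
    proof -
      have p': "p = (\<lambda>t. \<Sum>n\<in>F. (if n \<in> G then b n else 0) * character n t)"
        unfolding G(2) using F G(1) by (intro ext sum.mono_neutral_cong_left) auto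
      have "I - S F \<le> (LINT t|unit_cell. (cmod (f t - p t))\<^sup>2)"
        unfolding p' integral_distance_trig_poly[OF assms F(1)] by (simp add: I_def S_def sum_nonneg)
      then show ?thesis using small bessel[OF F(1)] by (simp add: dist_real_def)
    qed
    then show ?thesis unfolding eventually_finite_subsets_at_top using G(1) by blast
  qed
  then have "(S \<longlongrightarrow> I) (finite_subsets_at_top UNIV)" by (rule tendstoI)
  then show ?thesis by (simp add: has_sum_def I_def S_def[abs_def])
qed

section \<open>Correlation with a bounded symbol\<close>

text \<open>Negative frequencies appear because correlation with \<open>a\<close>, rather than convolution, is a multiplication by the symbol of \<open>a\<close>
  when the sequence \<open>x\<close> is represented by the sum of \<open>x\<^sub>n e(- n t)\<close>.\<close>

lemma integral_cmod_square_trig_sum: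
  assumes "finite T"
  shows "(LINT t|unit_cell. (cmod (\<Sum>n\<in>T. b n * character (- n) t))\<^sup>2) = (\<Sum>n\<in>T. (cmod (b n))\<^sup>2)"
proof -
  have "(\<Sum>n\<in>T. b n * character (- n) t) = (\<Sum>m\<in>uminus ` T. b (- m) * character m t)" for t
    by (simp add: sum.reindex)
  moreover have "(\<Sum>n\<in>T. (cmod (b n))\<^sup>2) = (\<Sum>m\<in>uminus ` T. (cmod (b (- m)))\<^sup>2)"
    by (simp add: sum.reindex)
  ultimately show ?thesis
    using integral_distance_trig_poly[of "\<lambda>_. 0" "uminus ` T" "\<lambda>m. b (- m)"] assms
    by (simp add: fourier_coeff_def)
qed

text \<open>A correlation operator on square-summable sequences has norm at most the supremum of its symbol. For
  finitely supported \<open>x\<close> the Fourier series of the correlation is the product of the symbol and the Fourier series of \<open>x\<close>, and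
  Parseval's identity for trigonometric polynomials applies. A finite part of the output depends on finitely many
  entries of \<open>x\<close> only, so the general case follows without a limit.\<close>

lemma correlation_bound:
  fixes a :: "int \<Rightarrow> complex"
  assumes Q: "finite Q" and B: "\<And>t. cmod (\<Sum>k\<in>Q. a k * character k t) \<le> B"
  shows "(\<integral>\<^sup>+n. ennreal ((cmod (\<Sum>k\<in>Q. a k * x (n + k)))\<^sup>2) \<partial>count_space UNIV)
    \<le> ennreal (B\<^sup>2) * (\<integral>\<^sup>+n. ennreal ((cmod (x n))\<^sup>2) \<partial>count_space UNIV)"
proof (rule nn_integral_count_space_le_finite_sums)
  fix T :: "int set" assume T: "finite T"
  \<comment> \<open>\<open>S\<close> contains the entries of \<open>x\<close> that influence the outputs in \<open>T\<close>, and \<open>T'\<close> contains all outputs that these entries influence.\<close>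
  define S where "S = (\<lambda>(n, k). n + k) ` (T \<times> Q)"
  define T' where "T' = T \<union> (\<lambda>(s, k). s - k) ` (S \<times> Q)"
  have fin: "finite S" "finite T'" using T Q by (auto simp: S_def T'_def)
  define z where "z m = (if m \<in> S then x m else 0)" for m
  define y where "y n = (\<Sum>k\<in>Q. a k * z (n + k))" for n
  have Y: "(\<Sum>n\<in>T'. y n * character (- n) t) = (\<Sum>k\<in>Q. a k * character k t) * (\<Sum>m\<in>S. x m * character (- m) t)" for t
  proof -
    have shift: "(\<Sum>n\<in>T'. z (n + k) * character (- (n + k)) t) = (\<Sum>m\<in>S. x m * character (- m) t)" if k: "k \<in> Q" for k
    proof -
      have "(\<Sum>n\<in>T'. z (n + k) * character (- (n + k)) t) = (\<Sum>m\<in>(\<lambda>n. n + k) ` T'. z m * character (- m) t)"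
        by (subst sum.reindex) (auto simp: inj_on_def)
      also have "\<dots> = (\<Sum>m\<in>S. x m * character (- m) t)"
      proof (rule sum.mono_neutral_cong_right)
        show "S \<subseteq> (\<lambda>n. n + k) ` T'"
        proof
          fix s assume "s \<in> S"
          then have "s - k \<in> T'" using k unfolding T'_def by force
          then show "s \<in> (\<lambda>n. n + k) ` T'" by (rule rev_image_eqI) simp
        qed
      qed (use fin in \<open>auto simp: z_def\<close>)
      finally show ?thesis .
    qed
    have "(\<Sum>n\<in>T'. y n * character (- n) t) = (\<Sum>n\<in>T'. \<Sum>k\<in>Q. a k * character k t * (z (n + k) * character (- (n + k)) t))"
    proof (intro sum.cong refl)
      fix n
      have "character (- n) t = character k t * character (- (n + k)) t" for k
        by (simp add: character_mult)
      then show "y n * character (- n) t = (\<Sum>k\<in>Q. a k * character k t * (z (n + k) * character (- (n + k)) t))"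
        unfolding y_def sum_distrib_right by (intro sum.cong refl) (simp only: mult_ac)
    qed
    also have "\<dots> = (\<Sum>k\<in>Q. a k * character k t * (\<Sum>n\<in>T'. z (n + k) * character (- (n + k)) t))"
      by (subst sum.swap) (simp only: sum_distrib_left)
    also have "\<dots> = (\<Sum>k\<in>Q. a k * character k t * (\<Sum>m\<in>S. x m * character (- m) t))"
      using shift by (intro sum.cong refl) simp
    finally show ?thesis by (simp only: sum_distrib_right)
  qed
  have int: "integrable unit_cell (\<lambda>t. (cmod (\<Sum>n\<in>R. b n * character (- n) t))\<^sup>2)" for R and b :: "int \<Rightarrow> complex"
  proof (rule finite_measure.integrable_const_bound[OF finite_measure_unit_cell])
    have "cmod (\<Sum>n\<in>R. b n * character (- n) t) \<le> (\<Sum>n\<in>R. cmod (b n))" for t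
      by (rule order_trans[OF norm_sum]) (simp add: norm_mult)
    then show "AE t in unit_cell. norm ((cmod (\<Sum>n\<in>R. b n * character (- n) t))\<^sup>2) \<le> (\<Sum>n\<in>R. cmod (b n))\<^sup>2"
      by (intro AE_I2) (simp add: power_mono)
  qed simp
  have "(\<Sum>n\<in>T. (cmod (\<Sum>k\<in>Q. a k * x (n + k)))\<^sup>2) = (\<Sum>n\<in>T. (cmod (y n))\<^sup>2)"
  proof (intro sum.cong refl)
    fix n assume "n \<in> T"
    then have "n + k \<in> S" if "k \<in> Q" for k using that unfolding S_def by force
    then show "(cmod (\<Sum>k\<in>Q. a k * x (n + k)))\<^sup>2 = (cmod (y n))\<^sup>2" by (simp add: y_def z_def)
  qed
  also have "\<dots> \<le> (\<Sum>n\<in>T'. (cmod (y n))\<^sup>2)" using fin by (intro sum_mono2) (auto simp: T'_def)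
  also have "\<dots> = (LINT t|unit_cell. (cmod (\<Sum>n\<in>T'. y n * character (- n) t))\<^sup>2)"
    by (rule integral_cmod_square_trig_sum[OF fin(2), symmetric])
  also have "\<dots> \<le> (LINT t|unit_cell. B\<^sup>2 * (cmod (\<Sum>m\<in>S. x m * character (- m) t))\<^sup>2)"
  proof (intro integral_mono int integrable_mult_right)
    fix t
    show "(cmod (\<Sum>n\<in>T'. y n * character (- n) t))\<^sup>2 \<le> B\<^sup>2 * (cmod (\<Sum>m\<in>S. x m * character (- m) t))\<^sup>2"
      unfolding Y norm_mult power_mult_distrib using B[of t] by (intro mult_right_mono power_mono) auto
  qed
  also have "\<dots> = B\<^sup>2 * (\<Sum>m\<in>S. (cmod (x m))\<^sup>2)"
    by (simp add: integral_cmod_square_trig_sum[OF fin(1)])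
  finally have le: "(\<Sum>n\<in>T. (cmod (\<Sum>k\<in>Q. a k * x (n + k)))\<^sup>2) \<le> B\<^sup>2 * (\<Sum>m\<in>S. (cmod (x m))\<^sup>2)" .
  have "(\<Sum>n\<in>T. ennreal ((cmod (\<Sum>k\<in>Q. a k * x (n + k)))\<^sup>2)) \<le> ennreal (B\<^sup>2 * (\<Sum>m\<in>S. (cmod (x m))\<^sup>2))"
    using le by (simp add: ennreal_leI)
  also have "\<dots> = ennreal (B\<^sup>2) * (\<Sum>m\<in>S. ennreal ((cmod (x m))\<^sup>2))"
    by (simp add: ennreal_mult' sum_nonneg)
  also have "(\<Sum>m\<in>S. ennreal ((cmod (x m))\<^sup>2)) = (\<integral>\<^sup>+m. ennreal ((cmod (x m))\<^sup>2) \<partial>count_space S)"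
    using fin by (simp add: nn_integral_count_space_finite)
  also have "\<dots> = (\<integral>\<^sup>+m. ennreal ((cmod (x m))\<^sup>2) * indicator S m \<partial>count_space UNIV)"
    by (simp add: nn_integral_count_space_indicator)
  also have "\<dots> \<le> (\<integral>\<^sup>+m. ennreal ((cmod (x m))\<^sup>2) \<partial>count_space UNIV)"
    by (intro nn_integral_mono) (simp split: split_indicator)
  finally show "(\<Sum>n\<in>T. ennreal ((cmod (\<Sum>k\<in>Q. a k * x (n + k)))\<^sup>2))
      \<le> ennreal (B\<^sup>2) * (\<integral>\<^sup>+n. ennreal ((cmod (x n))\<^sup>2) \<partial>count_space UNIV)"
    by (simp add: mult_left_mono)
qed auto

section \<open>Periodization\<close>

text \<open>The line is the disjoint union of the translates of \<open>[0, 1)\<close> by integers.\<close>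

lemma nn_integral_periodize:
  assumes [measurable]: "F \<in> borel_measurable borel"
  shows "(\<integral>\<^sup>+x. F x \<partial>lborel) = (\<integral>\<^sup>+t. \<integral>\<^sup>+n. F (t + of_int n) \<partial>count_space UNIV \<partial>unit_cell)"
proof -
  have "F x = (\<integral>\<^sup>+n. F x * indicator {of_int n..<of_int n + 1} x \<partial>count_space UNIV)" for x
  proof -
    have "(\<integral>\<^sup>+n. F x * indicator {of_int n..<of_int n + 1} x \<partial>count_space UNIV)
        = (\<integral>\<^sup>+n. F x * indicator {\<lfloor>x\<rfloor>} n \<partial>count_space UNIV)"
    proof (rule nn_integral_cong)
      fix n :: int
      have "of_int n \<le> x \<and> x < of_int n + 1 \<longleftrightarrow> n = \<lfloor>x\<rfloor>" by linarith
      then show "F x * indicator {of_int n..<of_int n + 1} x = F x * indicator {\<lfloor>x\<rfloor>} n"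
        by (simp add: indicator_def)
    qed
    also have "\<dots> = F x" by (subst nn_integral_cmult_indicator) auto
    finally show ?thesis by (rule sym)
  qed
  then have "(\<integral>\<^sup>+x. F x \<partial>lborel) = (\<integral>\<^sup>+x. \<integral>\<^sup>+n. F x * indicator {of_int n..<of_int n + 1} x \<partial>count_space UNIV \<partial>lborel)"
    by (rule nn_integral_cong)
  also have "\<dots> = (\<integral>\<^sup>+n. \<integral>\<^sup>+x. F x * indicator {of_int n..<of_int n + 1} x \<partial>lborel \<partial>count_space UNIV)"
    by (rule nn_integral_count_space_nn_integral) auto
  also have "\<dots> = (\<integral>\<^sup>+n. \<integral>\<^sup>+t. F (t + of_int n) * indicator {0..<1} t \<partial>lborel \<partial>count_space UNIV)"
  proof (rule nn_integral_cong)
    fix n :: int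
    show "(\<integral>\<^sup>+x. F x * indicator {of_int n..<of_int n + 1} x \<partial>lborel) = (\<integral>\<^sup>+t. F (t + of_int n) * indicator {0..<1} t \<partial>lborel)"
      by (subst nn_integral_real_affine[where c = 1 and t = "of_int n"])
        (auto intro!: nn_integral_cong simp: add.commute split: split_indicator)
  qed
  also have "\<dots> = (\<integral>\<^sup>+t. \<integral>\<^sup>+n. F (t + of_int n) * indicator {0..<1} t \<partial>count_space UNIV \<partial>lborel)"
    by (rule nn_integral_count_space_nn_integral[symmetric]) auto
  also have "\<dots> = (\<integral>\<^sup>+t. (\<integral>\<^sup>+n. F (t + of_int n) \<partial>count_space UNIV) * indicator {0..<1} t \<partial>lborel)"
    by (intro nn_integral_cong) (simp add: nn_integral_multc)
  also have "\<dots> = (\<integral>\<^sup>+t. \<integral>\<^sup>+n. F (t + of_int n) \<partial>count_space UNIV \<partial>unit_cell)"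
    by (rule nn_integral_restrict_space[symmetric]) simp
  finally show ?thesis .
qed

lemma measurable_add_of_int [measurable]:
  "(\<lambda>z. fst z + of_int (snd z)) \<in> unit_cell \<Otimes>\<^sub>M count_space (UNIV :: int set) \<rightarrow>\<^sub>M borel"
proof -
  have "fst \<in> unit_cell \<Otimes>\<^sub>M count_space (UNIV :: int set) \<rightarrow>\<^sub>M borel"
    by (rule measurable_compose[OF measurable_fst]) (rule borel_measurable_unit_cell, simp)
  moreover have "(\<lambda>z. real_of_int (snd z)) \<in> unit_cell \<Otimes>\<^sub>M count_space (UNIV :: int set) \<rightarrow>\<^sub>M borel"
    by (rule measurable_compose[OF measurable_snd]) simp
  ultimately show ?thesis by (rule borel_measurable_add)
qed

lemma sigma_finite_count_space_int: "sigma_finite_measure (count_space (UNIV :: int set))"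
  by (rule sigma_finite_measure_count_space_countable) simp

text \<open>In this form the decomposition of the line yields Fubini's theorem for integrable functions of any sign.\<close>

lemma lborel_eq_distr_unit_cell:
  "lborel = distr (unit_cell \<Otimes>\<^sub>M count_space (UNIV :: int set)) borel (\<lambda>z. fst z + of_int (snd z))"
proof (rule measure_eqI)
  fix A :: "real set" assume "A \<in> sets lborel"
  then have [measurable]: "A \<in> sets borel" by simp
  have "emeasure (distr (unit_cell \<Otimes>\<^sub>M count_space (UNIV :: int set)) borel (\<lambda>z. fst z + of_int (snd z))) A
     = (\<integral>\<^sup>+x. indicator A x \<partial>distr (unit_cell \<Otimes>\<^sub>M count_space (UNIV :: int set)) borel (\<lambda>z. fst z + of_int (snd z)))"
    by simp
  also have "\<dots> = (\<integral>\<^sup>+z. indicator A (fst z + of_int (snd z)) \<partial>(unit_cell \<Otimes>\<^sub>M count_space (UNIV :: int set)))"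
    by (rule nn_integral_distr[OF measurable_add_of_int]) simp
  also have "\<dots> = (\<integral>\<^sup>+t. \<integral>\<^sup>+n. indicator A (fst (t, n) + of_int (snd (t, n))) \<partial>count_space UNIV \<partial>unit_cell)"
    by (rule sigma_finite_measure.nn_integral_fst[OF sigma_finite_count_space_int, symmetric])
      (rule measurable_compose[OF measurable_add_of_int], simp)
  also have "\<dots> = (\<integral>\<^sup>+x. indicator A x \<partial>lborel)"
    unfolding fst_conv snd_conv by (rule nn_integral_periodize[symmetric]) simp
  finally show "emeasure lborel A
     = emeasure (distr (unit_cell \<Otimes>\<^sub>M count_space (UNIV :: int set)) borel (\<lambda>z. fst z + of_int (snd z))) A"
    by simp
qed simp

lemma integral_periodize:
  fixes F :: "real \<Rightarrow> 'b::{banach, second_countable_topology}"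
  assumes "integrable lborel F"
  shows "(LINT x|lborel. F x) = (LINT t|unit_cell. LINT n|count_space UNIV. F (t + of_int n))"
proof -
  interpret pair_sigma_finite unit_cell "count_space (UNIV :: int set)"
    by (intro pair_sigma_finite.intro sigma_finite_count_space_int finite_measure.axioms(1) finite_measure_unit_cell)
  let ?D = "distr (unit_cell \<Otimes>\<^sub>M count_space (UNIV :: int set)) borel (\<lambda>z. fst z + of_int (snd z))"
  have F [measurable]: "F \<in> borel_measurable borel" using assms borel_measurable_integrable by fastforce
  have "integrable ?D F" using assms by (simp only: lborel_eq_distr_unit_cell[symmetric])
  then have int: "integrable (unit_cell \<Otimes>\<^sub>M count_space (UNIV :: int set)) (\<lambda>z. F (fst z + of_int (snd z)))"
    by (subst (asm) integrable_distr_eq) auto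
  have "(LINT x|lborel. F x) = (LINT x|?D. F x)" by (simp only: lborel_eq_distr_unit_cell[symmetric])
  also have "\<dots> = (LINT z|(unit_cell \<Otimes>\<^sub>M count_space (UNIV :: int set)). F (fst z + of_int (snd z)))"
    by (rule integral_distr) auto
  also have "\<dots> = (LINT t|unit_cell. LINT n|count_space UNIV. F (fst (t, n) + of_int (snd (t, n))))"
    by (rule integral_fst'[OF int, symmetric])
  finally show ?thesis by simp
qed

section \<open>Functions that are constant on cells\<close>

text \<open>The interval \<open>[0, 1)\<close> is cut at the points \<open>1 - 1/(i + 1)\<close>, and \<open>cell_index x\<close> is the number of the piece
  that contains the fractional part of \<open>x\<close>. Any partition into countably many sets of positive
  measure would serve; this one has an explicit index function.\<close>

definition cell_index :: "real \<Rightarrow> nat" where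
  "cell_index x = nat \<lfloor>1 / (1 - frac x)\<rfloor> - 1"

definition cell_width :: "nat \<Rightarrow> real" where
  "cell_width i = 1 / (real i + 1) - 1 / (real i + 2)"

text \<open>The function with the constant value \<open>v i n\<close> on the \<open>i\<close>-th cell of the interval \<open>[n, n + 1)\<close>. Translations
  by integers act on the second argument of \<open>v\<close> alone.\<close>

definition cell_fun :: "(nat \<Rightarrow> int \<Rightarrow> 'b) \<Rightarrow> real \<Rightarrow> 'b" where
  "cell_fun v x = v (cell_index x) \<lfloor>x\<rfloor>"

definition cell :: "nat \<Rightarrow> int \<Rightarrow> real set" where
  "cell i n = {of_int n + 1 - 1 / (real i + 1)..<of_int n + 1 - 1 / (real i + 2)}"

lemma cell_width_pos: "0 < cell_width i"
  by (simp add: cell_width_def divide_strict_left_mono)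

text \<open>The widths telescope.\<close>

lemma cell_width_sums: "cell_width sums 1"
proof -
  have "(\<lambda>n. 1 / (real n + 1)) \<longlonglongrightarrow> 0"
    using LIMSEQ_inverse_real_of_nat by (simp add: inverse_eq_divide add.commute)
  then have "(\<lambda>n. 1 / (real n + 1) - 1 / (real (Suc n) + 1)) sums (1 / (real 0 + 1) - 0)"
    by (rule telescope_sums')
  then show ?thesis by (simp add: cell_width_def[abs_def] add.commute)
qed

lemma cell_index_add_of_int: "cell_index (x + of_int n) = cell_index x"
  by (simp add: cell_index_def frac_def)

lemma cell_fun_add_of_int: "cell_fun v (x + of_int n) = v (cell_index x) (\<lfloor>x\<rfloor> + n)"
  by (simp add: cell_fun_def cell_index_add_of_int)

lemma mem_cell_iff: "x \<in> cell i n \<longleftrightarrow> cell_index x = i \<and> \<lfloor>x\<rfloor> = n"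
proof -
  define s where "s = 1 - frac x"
  have s: "0 < s" "s \<le> 1" using frac_lt_1[of x] frac_ge_0[of x] by (auto simp: s_def)
  have "1 \<le> 1 / s" using s by simp
  then have fl: "1 \<le> \<lfloor>1 / s\<rfloor>" by linarith
  have "cell_index x = i \<longleftrightarrow> \<lfloor>1 / s\<rfloor> = int i + 1"
    unfolding cell_index_def s_def[symmetric] using fl by linarith
  also have "\<dots> \<longleftrightarrow> real i + 1 \<le> 1 / s \<and> 1 / s < real i + 2" by (auto simp: floor_eq_iff)
  also have "\<dots> \<longleftrightarrow> 1 / (real i + 2) < s \<and> s \<le> 1 / (real i + 1)"
    using s by (auto simp: field_simps)
  finally have idx: "cell_index x = i \<longleftrightarrow> 1 / (real i + 2) < s \<and> s \<le> 1 / (real i + 1)" .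
  have x: "x = of_int \<lfloor>x\<rfloor> + 1 - s" by (simp add: s_def frac_def)
  show ?thesis
  proof
    assume c: "x \<in> cell i n"
    have "0 < 1 / (real i + 2)" "1 / (real i + 1) \<le> 1" by (auto simp: field_simps)
    then have "of_int n \<le> x" "x < of_int n + 1" using c unfolding cell_def atLeastLessThan_iff by linarith+
    then have n: "\<lfloor>x\<rfloor> = n" by linarith
    show "cell_index x = i \<and> \<lfloor>x\<rfloor> = n"
      unfolding idx using c x n unfolding cell_def by auto
  next
    assume "cell_index x = i \<and> \<lfloor>x\<rfloor> = n"
    then show "x \<in> cell i n" using x unfolding idx cell_def by auto
  qed
qed

lemma has_bochner_integral_cell: "has_bochner_integral lborel (indicator (cell i n) :: real \<Rightarrow> real) (cell_width i)"
proof -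
  have "1 / (real i + 2) \<le> 1 / (real i + 1)" by (simp add: field_simps)
  then have "emeasure lborel (cell i n) = ennreal (cell_width i)"
    by (simp add: cell_def cell_width_def)
  then show ?thesis
    using has_bochner_integral_real_indicator[of "cell i n" lborel] cell_width_pos[of i]
    by (simp add: cell_def measure_def)
qed

text \<open>On each cell index \<open>i\<close> the function takes finitely many nonzero values, and the pieces for
  different \<open>i\<close> have disjoint supports, so their sum can be integrated termwise.\<close>

lemma integral_cell_fun:
  fixes v :: "nat \<Rightarrow> int \<Rightarrow> 'b::{banach, second_countable_topology}"
  assumes fin: "\<And>i. finite (N i)" and supp: "\<And>i n. n \<notin> N i \<Longrightarrow> v i n = 0"
    and summable: "summable (\<lambda>i. cell_width i * (\<Sum>n\<in>N i. norm (v i n)))"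
  shows "integrable lborel (cell_fun v)"
    and "(LINT x|lborel. cell_fun v x) = (\<Sum>i. cell_width i *\<^sub>R (\<Sum>n\<in>N i. v i n))"
proof -
  have hb: "has_bochner_integral lborel (\<lambda>x. \<Sum>n\<in>N i. indicator (cell i n) x *\<^sub>R w n)
      (cell_width i *\<^sub>R (\<Sum>n\<in>N i. w n))" for i and w :: "int \<Rightarrow> 'c::{banach, second_countable_topology}"
    unfolding scaleR_sum_right
    by (intro has_bochner_integral_sum has_bochner_integral_scaleR_left has_bochner_integral_cell)
  define f where "f i x = (\<Sum>n\<in>N i. indicator (cell i n) x *\<^sub>R v i n)" for i x
  have val: "(\<Sum>n\<in>N i. indicator (cell i n) x *\<^sub>R w n) = (if cell_index x = i \<and> \<lfloor>x\<rfloor> \<in> N i then w \<lfloor>x\<rfloor> else 0)"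
    for i x and w :: "int \<Rightarrow> 'c::{banach, second_countable_topology}"
  proof -
    have "(\<Sum>n\<in>N i. indicator (cell i n) x *\<^sub>R w n) = (\<Sum>n\<in>N i. if n = \<lfloor>x\<rfloor> then (if cell_index x = i then w n else 0) else 0)"
      by (intro sum.cong refl) (auto simp: indicator_def mem_cell_iff)
    then show ?thesis using fin by simp
  qed
  have f_eq: "f i x = (if i = cell_index x then cell_fun v x else 0)" for i x
    unfolding f_def val cell_fun_def using supp by auto
  have norm_f: "norm (f i x) = (\<Sum>n\<in>N i. indicator (cell i n) x *\<^sub>R norm (v i n))" for i x
    unfolding f_def val by simp
  have sums: "(\<lambda>i. f i x) sums cell_fun v x" for x
    unfolding f_eq using sums_single[of "cell_index x" "\<lambda>_. cell_fun v x"] by simp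
  have eq: "(\<lambda>x. \<Sum>i. f i x) = cell_fun v" using sums by (auto simp: sums_iff)
  have i1: "integrable lborel (f i)" for i
    using hb[of i "v i"] unfolding f_def by (auto simp: has_bochner_integral_iff)
  have i2: "AE x in lborel. summable (\<lambda>i. norm (f i x))"
  proof (rule AE_I2)
    fix x show "summable (\<lambda>i. norm (f i x))"
      by (rule summable_finite[of "{cell_index x}"]) (auto simp: f_eq)
  qed
  have "(LINT x|lborel. norm (f i x)) = cell_width i * (\<Sum>n\<in>N i. norm (v i n))" for i
    unfolding norm_f using hb[of i "\<lambda>n. norm (v i n)"] by (simp add: has_bochner_integral_iff)
  then have i3: "summable (\<lambda>i. LINT x|lborel. norm (f i x))" using summable by simp
  show "integrable lborel (cell_fun v)" using integrable_suminf[OF i1 i2 i3] unfolding eq .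
  have "(LINT x|lborel. f i x) = cell_width i *\<^sub>R (\<Sum>n\<in>N i. v i n)" for i
    unfolding f_def using hb[of i "v i"] by (simp add: has_bochner_integral_iff)
  then show "(LINT x|lborel. cell_fun v x) = (\<Sum>i. cell_width i *\<^sub>R (\<Sum>n\<in>N i. v i n))"
    using integral_suminf[OF i1 i2 i3] unfolding eq by simp
qed

lemma borel_measurable_cell_fun [measurable]:
  fixes v :: "nat \<Rightarrow> int \<Rightarrow> 'b::topological_space"
  shows "cell_fun v \<in> borel_measurable borel"
proof -
  have "(\<lambda>x. (cell_index x, \<lfloor>x\<rfloor>)) \<in> borel \<rightarrow>\<^sub>M count_space (UNIV :: (nat \<times> int) set)"
  proof (subst measurable_count_space_eq2_countable, safe)
    fix i n
    have "(\<lambda>x. (cell_index x, \<lfloor>x\<rfloor>)) -` {(i, n)} \<inter> space borel = cell i n"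
      by (auto simp: mem_cell_iff)
    then show "(\<lambda>x. (cell_index x, \<lfloor>x\<rfloor>)) -` {(i, n)} \<inter> space borel \<in> sets borel"
      by (simp add: cell_def)
  qed auto
  from measurable_compose[OF this, of "\<lambda>(i, n). v i n" borel]
  show ?thesis by (simp add: cell_fun_def[abs_def])
qed

lemma cell_fun_in_L2:
  fixes v :: "nat \<Rightarrow> int \<Rightarrow> complex"
  assumes "\<And>i. finite (N i)" "\<And>i n. n \<notin> N i \<Longrightarrow> v i n = 0"
    and "summable (\<lambda>i. cell_width i * (\<Sum>n\<in>N i. (cmod (v i n))\<^sup>2))"
  shows "cell_fun v \<in> L2"
proof -
  have "integrable lborel (cell_fun (\<lambda>i n. (cmod (v i n))\<^sup>2))"
    by (rule integral_cell_fun(1)[where N = N]) (use assms in auto)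
  moreover have "cell_fun (\<lambda>i n. (cmod (v i n))\<^sup>2) = (\<lambda>x. (cmod (cell_fun v x))\<^sup>2)"
    by (simp add: cell_fun_def[abs_def])
  ultimately show ?thesis by (simp add: L2_def)
qed

section \<open>A criterion for frames\<close>

text \<open>This is why the identity plus an operator of norm at most \<open>1/2\<close> is bounded above and below. The lower bound is
  left in an additive form that can be integrated even where the quantities may be infinite.\<close>

lemma nn_integral_perturbation_bounds:
  assumes [measurable]: "f \<in> borel_measurable M" "g \<in> borel_measurable M"
    and small: "(\<integral>\<^sup>+x. ennreal ((cmod (g x))\<^sup>2) \<partial>M) \<le> ennreal (1/4) * (\<integral>\<^sup>+x. ennreal ((cmod (f x))\<^sup>2) \<partial>M)"
  shows "(\<integral>\<^sup>+x. ennreal ((cmod (f x + g x))\<^sup>2) \<partial>M) \<le> ennreal (5/2) * (\<integral>\<^sup>+x. ennreal ((cmod (f x))\<^sup>2) \<partial>M)"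
    and "(\<integral>\<^sup>+x. ennreal ((cmod (f x))\<^sup>2) \<partial>M)
      \<le> 2 * (\<integral>\<^sup>+x. ennreal ((cmod (f x + g x))\<^sup>2) \<partial>M) + ennreal (1/2) * (\<integral>\<^sup>+x. ennreal ((cmod (f x))\<^sup>2) \<partial>M)"
proof -
  let ?X = "\<integral>\<^sup>+x. ennreal ((cmod (f x))\<^sup>2) \<partial>M"
  let ?Y = "\<integral>\<^sup>+x. ennreal ((cmod (g x))\<^sup>2) \<partial>M"
  have Y: "2 * ?Y \<le> ennreal (1/2) * ?X"
  proof -
    have "2 * ?Y \<le> 2 * (ennreal (1/4) * ?X)" using small by (intro mult_left_mono) auto
    also have "\<dots> = (2 * ennreal (1/4)) * ?X" by (simp only: mult.assoc)
    also have "2 * ennreal (1/4) = ennreal (1/2)" by (subst two_times_ennreal) auto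
    finally show ?thesis .
  qed
  have "(\<integral>\<^sup>+x. ennreal ((cmod (f x + g x))\<^sup>2) \<partial>M) \<le> 2 * ?X + 2 * ?Y"
    by (rule nn_integral_cmod_add_power2_le) auto
  also have "\<dots> \<le> ennreal 2 * ?X + ennreal (1/2) * ?X" using Y by (intro add_mono) auto
  also have "\<dots> = (ennreal 2 + ennreal (1/2)) * ?X" by (simp only: distrib_right)
  also have "ennreal 2 + ennreal (1/2) = ennreal (5/2)" by (subst ennreal_plus[symmetric]) auto
  finally show "(\<integral>\<^sup>+x. ennreal ((cmod (f x + g x))\<^sup>2) \<partial>M) \<le> ennreal (5/2) * ?X" .
  have "?X = (\<integral>\<^sup>+x. ennreal ((cmod ((f x + g x) + - g x))\<^sup>2) \<partial>M)" by simp
  also have "\<dots> \<le> 2 * (\<integral>\<^sup>+x. ennreal ((cmod (f x + g x))\<^sup>2) \<partial>M) + 2 * (\<integral>\<^sup>+x. ennreal ((cmod (- g x))\<^sup>2) \<partial>M)"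
    by (rule nn_integral_cmod_add_power2_le) auto
  also have "\<dots> \<le> 2 * (\<integral>\<^sup>+x. ennreal ((cmod (f x + g x))\<^sup>2) \<partial>M) + ennreal (1/2) * ?X"
    using Y by (intro add_mono) auto
  finally show "?X \<le> 2 * (\<integral>\<^sup>+x. ennreal ((cmod (f x + g x))\<^sup>2) \<partial>M) + ennreal (1/2) * ?X" .
qed

lemma borel_measurable_nn_integral_int:
  fixes h :: "int \<Rightarrow> 'a \<Rightarrow> ennreal"
  assumes [measurable]: "\<And>n. h n \<in> borel_measurable M"
  shows "(\<lambda>x. \<integral>\<^sup>+n. h n x \<partial>count_space UNIV) \<in> borel_measurable M"
proof -
  have "(\<integral>\<^sup>+n. h n x \<partial>count_space UNIV) = (\<Sum>k. h (int_decode k) x)" for x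
    using nn_integral_bij_count_space[OF bij_int_decode, of "\<lambda>n. h n x"]
    by (simp add: nn_integral_count_space_nat)
  then show ?thesis by simp
qed

text \<open>The bracket product of \<open>f\<close> and the translate of \<open>g\<close> by \<open>n\<close>: the periodization of the product of \<open>f\<close> and the
  conjugate of that translate. Its Fourier coefficients are the frame coefficients with translation index \<open>n\<close>.\<close>

definition bracket_product :: "(real \<Rightarrow> complex) \<Rightarrow> (real \<Rightarrow> complex) \<Rightarrow> int \<Rightarrow> real \<Rightarrow> complex" where
  "bracket_product f g n t = (LINT l|count_space UNIV. f (t + of_int l) * cnj (g (t + of_int l - of_int n)))"

lemma borel_measurable_cnj [measurable]: "cnj \<in> borel_measurable borel"
  by (intro borel_measurable_continuous_onI continuous_intros)

lemma borel_measurable_bracket_product: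
  assumes [measurable]: "f \<in> borel_measurable borel" "g \<in> borel_measurable borel"
  shows "bracket_product f g n \<in> borel_measurable unit_cell"
proof -
  have "(\<lambda>x. f x * cnj (g (x - of_int n))) \<in> borel_measurable borel" by simp
  from measurable_compose[OF measurable_add_of_int this]
  have "(\<lambda>(t, l). f (t + of_int l) * cnj (g (t + of_int l - of_int n)))
      \<in> borel_measurable (unit_cell \<Otimes>\<^sub>M count_space (UNIV :: int set))"
    by (simp add: case_prod_unfold)
  then show ?thesis
    unfolding bracket_product_def
    by (rule sigma_finite_measure.borel_measurable_lebesgue_integral[OF sigma_finite_count_space_int])
qed

lemma integrable_mult_L2:
  assumes f: "f \<in> L2" and g: "g \<in> L2"
  shows "integrable lborel (\<lambda>x. f x * cnj (g x))"
proof (rule Bochner_Integration.integrable_bound)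
  show "integrable lborel (\<lambda>x. (cmod (f x))\<^sup>2 + (cmod (g x))\<^sup>2)"
    using f g by (auto simp: L2_def)
  have [measurable]: "f \<in> borel_measurable borel" "g \<in> borel_measurable borel"
    using f g by (auto simp: L2_def)
  show "(\<lambda>x. f x * cnj (g x)) \<in> borel_measurable lborel" by simp
  have "u * v \<le> u\<^sup>2 + v\<^sup>2" if "0 \<le> u" "0 \<le> v" for u v :: real
  proof -
    have "2 * (u * v) \<le> u\<^sup>2 + v\<^sup>2"
      using zero_le_power2[of "u - v"] by (simp add: power2_eq_square algebra_simps)
    moreover have "0 \<le> u * v" using that by simp
    ultimately show ?thesis by linarith
  qed
  then show "AE x in lborel. norm (f x * cnj (g x)) \<le> norm ((cmod (f x))\<^sup>2 + (cmod (g x))\<^sup>2)"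
    by (simp add: norm_mult)
qed

lemma modulation_translation_eq:
  "modulation (of_int m) (translation (of_int n) g) = (\<lambda>x. character m x * g (x - of_int n))"
  by (simp add: modulation_def translation_def character_def cis_conv_exp mult_ac)

lemma modulation_translation_in_L2:
  assumes "g \<in> L2"
  shows "modulation (of_int m) (translation (of_int n) g) \<in> L2"
proof -
  have [measurable]: "g \<in> borel_measurable borel" and i: "integrable lborel (\<lambda>x. (cmod (g x))\<^sup>2)"
    using assms by (auto simp: L2_def)
  have "integrable lborel (\<lambda>x. (cmod (g (- of_int n + 1 * x)))\<^sup>2)"
    by (rule lborel_integrable_real_affine[OF i]) simp
  then show ?thesis unfolding modulation_translation_eq by (simp add: L2_def norm_mult)
qed

text \<open>Modulations by integers have period 1, so they can be taken out of the periodization.\<close>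

lemma WH_coeff_eq_fourier_coeff:
  assumes f: "f \<in> L2" and g: "g \<in> L2"
  shows "WH_coeff g f (m, n) = fourier_coeff (bracket_product f g n) m"
proof -
  let ?h = "\<lambda>x. f x * cnj (character m x * g (x - of_int n))"
  have int: "integrable lborel ?h"
    using integrable_mult_L2[OF f modulation_translation_in_L2[OF g, of m n]]
    unfolding modulation_translation_eq .
  have "WH_coeff g f (m, n) = (LINT x|lborel. ?h x)"
    unfolding WH_coeff_def L2_inner_def modulation_translation_eq by simp
  also have "\<dots> = (LINT t|unit_cell. LINT l|count_space UNIV. ?h (t + of_int l))"
    by (rule integral_periodize[OF int])
  also have "\<dots> = (LINT t|unit_cell. bracket_product f g n t * character (- m) t)"
  proof (rule Bochner_Integration.integral_cong)
    fix t
    have "?h (t + of_int l) = (f (t + of_int l) * cnj (g (t + of_int l - of_int n))) * character (- m) t" for l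
      by (simp add: character_add_of_int mult_ac)
    then show "(LINT l|count_space UNIV. ?h (t + of_int l)) = bracket_product f g n t * character (- m) t"
      unfolding bracket_product_def by (simp only: integral_mult_left_zero)
  qed simp
  finally show ?thesis by (simp add: fourier_coeff_def)
qed

text \<open>For a fixed \<open>t\<close> the bracket products, as a sequence in \<open>n\<close>, are the sequence \<open>f(t + n)\<close> plus its correlation with
  the finite sequence \<open>q\<close> that belongs to the cell of \<open>t\<close>.\<close>

lemma bracket_product_cell_fun:
  fixes q :: "nat \<Rightarrow> int \<Rightarrow> real"
  assumes fin: "finite (Q (cell_index t))" and supp: "\<And>k. k \<notin> Q (cell_index t) \<Longrightarrow> q (cell_index t) k = 0"
    and t: "t \<in> {0..<1}"
  shows "bracket_product f (cell_fun (\<lambda>i n. of_real (of_bool (n = 0) + q i n))) n t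
    = f (t + of_int n) + (\<Sum>k\<in>Q (cell_index t). of_real (q (cell_index t) k) * f (t + of_int (n + k)))"
proof -
  let ?i = "cell_index t"
  let ?c = "\<lambda>l. complex_of_real (of_bool (l = 0) + q ?i l)"
  let ?S = "insert n ((\<lambda>k. n + k) ` Q ?i)"
  have sub: "{l. f (t + of_int l) * ?c (l - n) \<noteq> 0} \<subseteq> ?S"
  proof
    fix l assume "l \<in> {l. f (t + of_int l) * ?c (l - n) \<noteq> 0}"
    then have "l = n \<or> l - n \<in> Q ?i" using supp[of "l - n"] by auto
    then show "l \<in> ?S" by force
  qed
  have fl: "\<lfloor>t\<rfloor> = 0" using t by (simp add: floor_eq_iff)
  have "cell_fun (\<lambda>i n. complex_of_real (of_bool (n = 0) + q i n)) (t + of_int l - of_int n) = ?c (l - n)" for l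
    using cell_fun_add_of_int[of "\<lambda>i n. complex_of_real (of_bool (n = 0) + q i n)" t "l - n"] fl
    by (simp add: algebra_simps)
  then have "bracket_product f (cell_fun (\<lambda>i n. of_real (of_bool (n = 0) + q i n))) n t
      = (LINT l|count_space UNIV. f (t + of_int l) * ?c (l - n))"
    unfolding bracket_product_def by simp
  also have "\<dots> = (\<Sum>l | f (t + of_int l) * ?c (l - n) \<noteq> 0. f (t + of_int l) * ?c (l - n))"
    using finite_subset[OF sub] fin by (subst lebesgue_integral_count_space_finite_support) auto
  also have "\<dots> = (\<Sum>l\<in>?S. f (t + of_int l) * ?c (l - n))"
    by (rule sum.mono_neutral_left[OF _ sub]) (use fin in auto)
  also have "\<dots> = (\<Sum>l\<in>?S. of_bool (l = n) * f (t + of_int l)) + (\<Sum>l\<in>?S. of_real (q ?i (l - n)) * f (t + of_int l))"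
    unfolding sum.distrib[symmetric] by (intro sum.cong refl) (simp add: algebra_simps)
  also have "(\<Sum>l\<in>?S. of_bool (l = n) * f (t + of_int l)) = f (t + of_int n)"
    using fin by (subst sum.mono_neutral_right[where S = "{n}"]) auto
  also have "(\<Sum>l\<in>?S. of_real (q ?i (l - n)) * f (t + of_int l))
      = (\<Sum>l\<in>(\<lambda>k. n + k) ` Q ?i. of_real (q ?i (l - n)) * f (t + of_int l))"
  proof (rule sum.mono_neutral_right)
    show "\<forall>l\<in>?S - (\<lambda>k. n + k) ` Q ?i. complex_of_real (q ?i (l - n)) * f (t + of_int l) = 0"
    proof
      fix l assume l: "l \<in> ?S - (\<lambda>k. n + k) ` Q ?i"
      then have "l - n \<notin> Q ?i" by force
      then show "complex_of_real (q ?i (l - n)) * f (t + of_int l) = 0" using supp by simp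
    qed
  qed (use fin in auto)
  also have "\<dots> = (\<Sum>k\<in>Q ?i. of_real (q ?i k) * f (t + of_int (n + k)))"
    by (subst sum.reindex) auto
  finally show ?thesis .
qed

text \<open>The assumption says that \<open>|Zg - 1| \<le> 1/2\<close>. Summing over the modulations by Parseval's identity and over the
  translations by \<open>correlation_bound\<close> compares the frame sum with the squared norm of \<open>f\<close>: the frame bounds are \<open>1/4\<close>
  and \<open>5/2\<close>.\<close>

lemma WH_frame_cell_fun:
  fixes q :: "nat \<Rightarrow> int \<Rightarrow> real"
  defines "g \<equiv> cell_fun (\<lambda>i n. complex_of_real (of_bool (n = 0) + q i n))"
  assumes fin: "\<And>i. finite (Q i)" and supp: "\<And>i k. k \<notin> Q i \<Longrightarrow> q i k = 0"
    and small: "\<And>i t. cmod (\<Sum>k\<in>Q i. of_real (q i k) * character k t) \<le> 1/2"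
    and g: "g \<in> L2"
  shows "WH_frame g"
  unfolding WH_frame_def
proof (rule exI[of _ "1/4"], intro conjI, simp, rule exI[of _ "5/2"], intro conjI ballI, simp)
  fix f assume f: "f \<in> L2"
  then have f_meas [measurable]: "f \<in> borel_measurable borel"
    and f2: "integrable lborel (\<lambda>x. (cmod (f x))\<^sup>2)" by (auto simp: L2_def)
  have g_meas [measurable]: "g \<in> borel_measurable borel" using g by (simp add: L2_def)
  let ?Z = "bracket_product f g"
  have Z_meas [measurable]: "?Z n \<in> borel_measurable unit_cell" for n
    by (rule borel_measurable_bracket_product) auto
  define r where "r = (L2_norm f)\<^sup>2"
  have r: "0 \<le> r" "r = (LINT x|lborel. (cmod (f x))\<^sup>2)"
    by (simp_all add: r_def L2_norm_def)
  define X where "X t = (\<integral>\<^sup>+n. ennreal ((cmod (f (t + of_int n)))\<^sup>2) \<partial>count_space UNIV)" for t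
  define P where "P t = (\<integral>\<^sup>+n. ennreal ((cmod (?Z n t))\<^sup>2) \<partial>count_space UNIV)" for t
  define W where "W = (\<integral>\<^sup>+t. P t \<partial>unit_cell)"
  have P_meas [measurable]: "P \<in> borel_measurable unit_cell"
    unfolding P_def[abs_def] by (rule borel_measurable_nn_integral_int) auto
  have pw: "P t \<le> ennreal (5/2) * X t" "X t \<le> 2 * P t + ennreal (1/2) * X t" if t: "t \<in> {0..<1}" for t
  proof -
    let ?i = "cell_index t"
    let ?y = "\<lambda>n. \<Sum>k\<in>Q ?i. complex_of_real (q ?i k) * f (t + of_int (n + k))"
    have Z: "?Z n t = f (t + of_int n) + ?y n" for n
      unfolding g_def by (rule bracket_product_cell_fun[where Q = Q, OF fin supp t])
    have y: "(\<integral>\<^sup>+n. ennreal ((cmod (?y n))\<^sup>2) \<partial>count_space UNIV)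
        \<le> ennreal (1/4) * (\<integral>\<^sup>+n. ennreal ((cmod (f (t + of_int n)))\<^sup>2) \<partial>count_space UNIV)"
      using correlation_bound[OF fin[of ?i] small[of ?i], of "\<lambda>n. f (t + of_int n)"]
      by (simp add: power2_eq_square)
    show "P t \<le> ennreal (5/2) * X t" "X t \<le> 2 * P t + ennreal (1/2) * X t"
      unfolding P_def X_def Z by (rule nn_integral_perturbation_bounds[OF _ _ y]; simp)+
  qed
  have XI: "(\<integral>\<^sup>+t. X t \<partial>unit_cell) = ennreal r"
  proof -
    have "(\<integral>\<^sup>+t. X t \<partial>unit_cell) = (\<integral>\<^sup>+x. ennreal ((cmod (f x))\<^sup>2) \<partial>lborel)"
      unfolding X_def by (rule nn_integral_periodize[symmetric]) auto
    also have "\<dots> = ennreal r" unfolding r(2) by (rule nn_integral_eq_integral[OF f2]) auto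
    finally show ?thesis .
  qed
  have X_meas [measurable]: "X \<in> borel_measurable unit_cell"
    unfolding X_def[abs_def]
    by (rule borel_measurable_nn_integral_int, rule borel_measurable_unit_cell) auto
  have W_le: "W \<le> ennreal (5/2) * ennreal r"
  proof -
    have "W \<le> (\<integral>\<^sup>+t. ennreal (5/2) * X t \<partial>unit_cell)"
      unfolding W_def using pw(1) by (intro nn_integral_mono) auto
    also have "\<dots> = ennreal (5/2) * ennreal r" unfolding XI[symmetric] by (rule nn_integral_cmult) simp
    finally show ?thesis .
  qed
  have W_ge: "ennreal r \<le> 2 * W + ennreal (1/2) * ennreal r"
  proof -
    have "ennreal r \<le> (\<integral>\<^sup>+t. 2 * P t + ennreal (1/2) * X t \<partial>unit_cell)"
      unfolding XI[symmetric] using pw(2) by (intro nn_integral_mono) auto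
    also have "\<dots> = (\<integral>\<^sup>+t. 2 * P t \<partial>unit_cell) + (\<integral>\<^sup>+t. ennreal (1/2) * X t \<partial>unit_cell)"
      by (rule nn_integral_add) simp_all
    also have "\<dots> = 2 * W + ennreal (1/2) * ennreal r"
      unfolding XI[symmetric] W_def by (simp add: nn_integral_cmult)
    finally show ?thesis .
  qed
  have "W \<le> ennreal (5/2 * r)" using W_le by (subst ennreal_mult') simp_all
  then have W_fin: "W < \<infinity>" by (rule le_less_trans) simp
  then obtain w where w: "W = ennreal w" "0 \<le> w" by (cases W) auto
  have w_le: "w \<le> 5/2 * r"
    using \<open>W \<le> ennreal (5/2 * r)\<close> r(1) unfolding w(1) by (subst (asm) ennreal_le_iff) auto
  have w_ge: "1/4 * r \<le> w"
  proof -
    have "ennreal (1/2) * ennreal r = ennreal (1/2 * r)" by (rule ennreal_mult'[symmetric]) simp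
    then have "2 * W + ennreal (1/2) * ennreal r = ennreal (2 * w + 1/2 * r)"
      unfolding w(1) two_times_ennreal[OF w(2)] using w(2) r(1) by (simp only:) (rule ennreal_plus[symmetric]; simp)
    then have "ennreal r \<le> ennreal (2 * w + 1/2 * r)" using W_ge by simp
    then have "r \<le> 2 * w + 1/2 * r" using r(1) w(2) by (subst (asm) ennreal_le_iff) auto
    then show ?thesis by linarith
  qed
  have column: "(\<integral>\<^sup>+m. ennreal ((cmod (WH_coeff g f (m, n)))\<^sup>2) \<partial>count_space UNIV)
      = (\<integral>\<^sup>+t. ennreal ((cmod (?Z n t))\<^sup>2) \<partial>unit_cell)" for n
  proof -
    have "(\<integral>\<^sup>+t. ennreal ((cmod (?Z n t))\<^sup>2) \<partial>unit_cell) \<le> W"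
      unfolding W_def P_def by (intro nn_integral_mono nn_integral_ge_point) simp
    then have lt: "(\<integral>\<^sup>+t. ennreal ((cmod (?Z n t))\<^sup>2) \<partial>unit_cell) < \<infinity>" using W_fin by (rule le_less_trans)
    have int: "integrable unit_cell (\<lambda>t. (cmod (?Z n t))\<^sup>2)"
      by (rule integrableI_bounded) (use lt in simp_all)
    show ?thesis
      unfolding WH_coeff_eq_fourier_coeff[OF f g] nn_integral_eq_integral[OF int AE_I2[OF zero_le_power2]]
      by (rule nn_integral_count_space_has_sum[OF parseval[OF Z_meas int]]) simp
  qed
  have "(\<integral>\<^sup>+p. ennreal ((cmod (WH_coeff g f p))\<^sup>2) \<partial>count_space UNIV)
      = (\<integral>\<^sup>+n. \<integral>\<^sup>+m. ennreal ((cmod (WH_coeff g f (m, n)))\<^sup>2) \<partial>count_space UNIV \<partial>count_space UNIV)"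
    by (rule nn_integral_snd_count_space[symmetric])
  also have "\<dots> = (\<integral>\<^sup>+n. \<integral>\<^sup>+t. ennreal ((cmod (?Z n t))\<^sup>2) \<partial>unit_cell \<partial>count_space UNIV)"
    unfolding column ..
  also have "\<dots> = W"
    unfolding W_def P_def by (rule nn_integral_count_space_nn_integral[symmetric]) simp_all
  finally have "(\<integral>\<^sup>+p. ennreal ((cmod (WH_coeff g f p))\<^sup>2) \<partial>count_space UNIV) = ennreal w"
    unfolding w(1) .
  then have hs: "((\<lambda>p. (cmod (WH_coeff g f p))\<^sup>2) has_sum w) UNIV"
    by (rule has_sum_nn_integral_count_space) (use w(2) in auto)
  show "(\<lambda>p. (cmod (WH_coeff g f p))\<^sup>2) summable_on UNIV" using hs by (rule has_sum_imp_summable)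
  show "1/4 * (L2_norm f)\<^sup>2 \<le> (\<Sum>\<^sub>\<infinity>p. (cmod (WH_coeff g f p))\<^sup>2)"
    using infsumI[OF hs] w_ge by (simp add: r_def)
  show "(\<Sum>\<^sub>\<infinity>p. (cmod (WH_coeff g f p))\<^sup>2) \<le> 5/2 * (L2_norm f)\<^sup>2"
    using infsumI[OF hs] w_le by (simp add: r_def)
qed

section \<open>Bounded sine sums\<close>

text \<open>Summation by parts: \<open>2 sin(x/2) sin(kx)\<close> is a difference of consecutive values of \<open>cos((k + 1/2)x)\<close>. The
  boundary term on the left-hand side makes the estimate telescope in an induction over \<open>N\<close>.\<close>

lemma sine_tail_bound:
  fixes x :: real
  assumes "m \<le> N"
  shows "\<bar>2 * sin (x / 2) * (\<Sum>k\<in>{m<..N}. sin (of_nat k * x) / of_nat k) + cos ((of_nat N + 1/2) * x) / (of_nat N + 1)\<bar>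
    \<le> 2 / (of_nat m + 1) - 1 / (of_nat N + 1)"
  using assms
proof (induction N rule: dec_induct)
  case base
  have "\<bar>cos ((of_nat m + 1/2) * x)\<bar> / (of_nat m + 1) \<le> 1 / (of_nat m + 1)"
    by (intro divide_right_mono) auto
  then show ?case by (simp add: abs_divide)
next
  case (step n)
  define X where "X = 2 * sin (x / 2) * (\<Sum>k\<in>{m<..n}. sin (of_nat k * x) / of_nat k)"
  define a where "a n = cos ((of_nat n + 1/2) * x)" for n :: nat
  have set: "{m<..Suc n} = insert (Suc n) {m<..n}" using step by auto
  have prod: "2 * sin (x / 2) * sin (of_nat (Suc n) * x) = a n - a (Suc n)"
    using cos_diff[of "of_nat (Suc n) * x" "x/2"] cos_add[of "of_nat (Suc n) * x" "x/2"]
    by (simp add: a_def algebra_simps add_divide_distrib)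
  have eq: "2 * sin (x / 2) * (\<Sum>k\<in>{m<..Suc n}. sin (of_nat k * x) / of_nat k) = X + (a n - a (Suc n)) / (of_nat n + 1)"
    unfolding set prod[symmetric] by (simp add: X_def algebra_simps)
  have IH: "\<bar>X + a n / (of_nat n + 1)\<bar> \<le> 2 / (of_nat m + 1) - 1 / (of_nat n + 1)"
    using step.IH by (simp add: X_def a_def)
  have le1: "\<bar>a (Suc n)\<bar> \<le> 1" by (simp add: a_def)
  have d: "0 \<le> 1 / (real n + 1) - 1 / (real n + 2)" by (simp add: field_simps)
  have "X + (a n - a (Suc n)) / (of_nat n + 1) + a (Suc n) / (of_nat n + 2)
      = (X + a n / (of_nat n + 1)) - a (Suc n) * (1 / (of_nat n + 1) - 1 / (of_nat n + 2))"
    by (simp add: diff_divide_distrib algebra_simps)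
  moreover have "\<bar>a (Suc n) * (1 / (real n + 1) - 1 / (real n + 2))\<bar> \<le> 1 / (real n + 1) - 1 / (real n + 2)"
    unfolding abs_mult using mult_mono[OF le1, of "\<bar>1 / (real n + 1) - 1 / (real n + 2)\<bar>" "1 / (real n + 1) - 1 / (real n + 2)"] d
    by simp
  ultimately have "\<bar>X + (a n - a (Suc n)) / (of_nat n + 1) + a (Suc n) / (of_nat n + 2)\<bar>
     \<le> 2 / (of_nat m + 1) - 1 / (of_nat n + 2)"
    using IH by linarith
  then show ?case unfolding eq by (simp add: a_def algebra_simps)
qed

lemma abs_sin_nat_mult_le: "\<bar>sin (of_nat k * x)\<bar> \<le> of_nat k * \<bar>sin x\<bar>" for x :: real
proof (induction k)
  case (Suc k)
  have "\<bar>sin (of_nat (Suc k) * x)\<bar> = \<bar>sin (of_nat k * x) * cos x + cos (of_nat k * x) * sin x\<bar>"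
    by (simp add: sin_add algebra_simps)
  also have "\<dots> \<le> \<bar>sin (of_nat k * x)\<bar> * \<bar>cos x\<bar> + \<bar>cos (of_nat k * x)\<bar> * \<bar>sin x\<bar>"
    by (metis abs_mult abs_triangle_ineq)
  also have "\<dots> \<le> \<bar>sin (of_nat k * x)\<bar> * 1 + 1 * \<bar>sin x\<bar>"
    by (intro add_mono mult_mono) auto
  finally show ?case using Suc by (simp add: algebra_simps)
qed auto

text \<open>With \<open>s = |sin(x/2)|\<close>, each summand is at most \<open>2s\<close>, which bounds the sum up to \<open>m \<approx> 1/s\<close> by 2; the remaining part is at most
  \<open>1/((m + 1) s) \<le> 1\<close> by summation by parts.\<close>

lemma sum_sin_over_k_bounded:
  fixes x :: real
  shows "\<bar>\<Sum>k=1..N. sin (of_nat k * x) / of_nat k\<bar> \<le> 3"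
proof (cases "sin (x / 2) = 0")
  case True
  have "sin x = 0" using sin_double[of "x/2"] True by simp
  then have "sin (of_nat k * x) = 0" for k :: nat using abs_sin_nat_mult_le[of k x] by simp
  then show ?thesis by simp
next
  case False
  define s where "s = \<bar>sin (x / 2)\<bar>"
  have s: "0 < s" using False by (simp add: s_def)
  define m where "m = nat \<lfloor>1 / s\<rfloor>"
  have ge0: "(0::int) \<le> \<lfloor>1 / s\<rfloor>" using s by simp
  have m: "real m * s \<le> 1" "1 \<le> (real m + 1) * s"
  proof -
    have "real m \<le> 1 / s" "1 / s < real m + 1" unfolding m_def using ge0 by linarith+
    then show "real m * s \<le> 1" "1 \<le> (real m + 1) * s" using s by (simp_all add: field_simps)
  qed
  have head: "\<bar>\<Sum>k\<in>{1..n}. sin (of_nat k * x) / of_nat k\<bar> \<le> 2 * s * real n" for n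
  proof -
    have "\<bar>\<Sum>k\<in>{1..n}. sin (of_nat k * x) / of_nat k\<bar> \<le> (\<Sum>k\<in>{1..n}. \<bar>sin (of_nat k * x) / of_nat k\<bar>)"
      by (rule sum_abs)
    also have "\<dots> \<le> (\<Sum>k\<in>{1..n}. 2 * s)"
    proof (rule sum_mono)
      fix k assume k: "k \<in> {1..n}"
      have sx: "\<bar>sin x\<bar> \<le> 2 * s"
      proof -
        have "\<bar>sin x\<bar> = 2 * s * \<bar>cos (x/2)\<bar>" using sin_double[of "x/2"] by (simp add: s_def abs_mult)
        also have "\<dots> \<le> 2 * s * 1" using s by (intro mult_left_mono) auto
        finally show ?thesis by simp
      qed
      have "\<bar>sin (of_nat k * x) / of_nat k\<bar> \<le> of_nat k * \<bar>sin x\<bar> / of_nat k"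
        unfolding abs_divide abs_of_nat using abs_sin_nat_mult_le[of k x] by (rule divide_right_mono) simp
      also have "\<dots> = \<bar>sin x\<bar>" using k by simp
      finally show "\<bar>sin (of_nat k * x) / of_nat k\<bar> \<le> 2 * s" using sx by simp
    qed
    finally show ?thesis by (simp add: mult.commute)
  qed
  show ?thesis
  proof (cases "m \<le> N")
    case False
    then have "s * real N \<le> s * real m" using s by simp
    then have "2 * s * real N \<le> 2" using m(1) by (simp add: mult.commute)
    then show ?thesis using head[of N] by linarith
  next
    case True
    let ?T = "\<Sum>k\<in>{m<..N}. sin (of_nat k * x) / of_nat k"
    let ?c = "cos ((of_nat N + 1/2) * x) / (of_nat N + 1)"
    have "\<bar>?c\<bar> \<le> 1 / (real N + 1)"
      unfolding abs_divide by (simp add: divide_right_mono)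
    then have "\<bar>2 * sin (x / 2) * ?T\<bar> \<le> 2 / (of_nat m + 1)"
      using sine_tail_bound[OF True, of x] by linarith
    then have "s * \<bar>?T\<bar> \<le> 1 / (of_nat m + 1)" by (simp add: abs_mult s_def)
    also have "\<dots> \<le> s" using m(2) by (simp add: field_simps)
    finally have T: "\<bar>?T\<bar> \<le> 1" using s by simp
    have split: "{1..N} = {1..m} \<union> {m<..N}" using True by auto
    have "(\<Sum>k=1..N. sin (of_nat k * x) / of_nat k) = (\<Sum>k=1..m. sin (of_nat k * x) / of_nat k) + ?T"
      unfolding split by (rule sum.union_disjoint) auto
    moreover have "2 * s * real m \<le> 2" using m(1) by (simp add: mult.commute)
    ultimately show ?thesis using T head[of m] by linarith
  qed
qed

section \<open>Windows with large partial sums\<close>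

text \<open>The coefficients of the polynomial \<open>q\<^sub>N\<close>: a truncated discrete Hilbert kernel, shifted to the
  frequency \<open>4N\<close>. The factor \<open>1/12\<close> makes the modulus of \<open>q\<^sub>N\<close> at most \<open>1/2\<close>.\<close>

definition hilbert_kernel :: "nat \<Rightarrow> int \<Rightarrow> real" where
  "hilbert_kernel N k = (if k \<noteq> 4 * int N \<and> \<bar>k - 4 * int N\<bar> \<le> int N then 1 / (12 * of_int (4 * int N - k)) else 0)"

definition hilbert_supp :: "nat \<Rightarrow> int set" where
  "hilbert_supp N = {3 * int N..5 * int N}"

lemma finite_hilbert_supp [simp]: "finite (hilbert_supp N)"
  by (simp add: hilbert_supp_def)

lemma hilbert_kernel_outside: "k \<notin> hilbert_supp N \<Longrightarrow> hilbert_kernel N k = 0"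
  by (auto simp: hilbert_kernel_def hilbert_supp_def)

text \<open>The terms at \<open>4N - i\<close> and \<open>4N + i\<close> combine to a multiple of \<open>sin(2 \<pi> i t) / i\<close>.\<close>

lemma hilbert_kernel_symbol_bound:
  "cmod (\<Sum>k\<in>hilbert_supp N. of_real (hilbert_kernel N k) * character k t) \<le> 1/2"
proof -
  let ?M = "4 * int N"
  let ?h = "\<lambda>k. complex_of_real (hilbert_kernel N k) * character k t"
  let ?A = "(\<lambda>i. ?M - int i) ` {1..N}" and ?B = "(\<lambda>i. ?M + int i) ` {1..N}"
  have "(\<Sum>k\<in>hilbert_supp N. ?h k) = (\<Sum>k\<in>?A \<union> ?B. ?h k)"
  proof (rule sum.mono_neutral_right)
    show "?A \<union> ?B \<subseteq> hilbert_supp N" by (auto simp: hilbert_supp_def)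
    show "\<forall>k\<in>hilbert_supp N - (?A \<union> ?B). ?h k = 0"
    proof
      fix k assume k: "k \<in> hilbert_supp N - (?A \<union> ?B)"
      have "k = ?M"
      proof (rule ccontr)
        assume "k \<noteq> ?M"
        then consider "k < ?M" | "?M < k" by linarith
        then show False
        proof cases
          case 1
          then have "k = ?M - int (nat (?M - k))" "nat (?M - k) \<in> {1..N}" using k by (auto simp: hilbert_supp_def)
          then show False using k by blast
        next
          case 2
          then have "k = ?M + int (nat (k - ?M))" "nat (k - ?M) \<in> {1..N}" using k by (auto simp: hilbert_supp_def)
          then show False using k by blast
        qed
      qed
      then show "?h k = 0" by (simp add: hilbert_kernel_def)
    qed
  qed simp
  also have "\<dots> = (\<Sum>k\<in>?A. ?h k) + (\<Sum>k\<in>?B. ?h k)" by (rule sum.union_disjoint) auto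
  also have "(\<Sum>k\<in>?A. ?h k) = (\<Sum>i=1..N. ?h (?M - int i))" by (subst sum.reindex) (auto simp: inj_on_def)
  also have "(\<Sum>k\<in>?B. ?h k) = (\<Sum>i=1..N. ?h (?M + int i))" by (subst sum.reindex) (auto simp: inj_on_def)
  also have "(\<Sum>i=1..N. ?h (?M - int i)) + (\<Sum>i=1..N. ?h (?M + int i))
      = (\<Sum>i=1..N. (character ?M t * (- \<i> / 6)) * of_real (sin (of_nat i * (2 * pi * t)) / of_nat i))"
    unfolding sum.distrib[symmetric]
  proof (intro sum.cong refl)
    fix i assume i: "i \<in> {1..N}"
    have h: "hilbert_kernel N (?M - int i) = 1 / (12 * real i)" "hilbert_kernel N (?M + int i) = - (1 / (12 * real i))"
      using i by (auto simp: hilbert_kernel_def)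
    have c: "character (?M - int i) t = character ?M t * character (- int i) t"
      "character (?M + int i) t = character ?M t * character (int i) t"
      by (simp_all add: character_mult)
    have s: "character (- int i) t - character (int i) t = - 2 * \<i> * of_real (sin (of_nat i * (2 * pi * t)))"
      by (simp add: complex_eq_iff character_def mult_ac)
    have "?h (?M - int i) + ?h (?M + int i)
        = character ?M t * (character (- int i) t - character (int i) t) * of_real (1 / (12 * real i))"
      unfolding h c by (simp add: algebra_simps)
    also have "\<dots> = (character ?M t * (- \<i> / 6)) * of_real (sin (of_nat i * (2 * pi * t)) / of_nat i)"
      unfolding s using i by (simp add: field_simps)
    finally show "?h (?M - int i) + ?h (?M + int i)
        = (character ?M t * (- \<i> / 6)) * of_real (sin (of_nat i * (2 * pi * t)) / of_nat i)" .
  qed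
  also have "\<dots> = (character ?M t * (- \<i> / 6)) * of_real (\<Sum>i=1..N. sin (of_nat i * (2 * pi * t)) / of_nat i)"
    unfolding of_real_sum sum_distrib_left ..
  finally have "cmod (\<Sum>k\<in>hilbert_supp N. ?h k) = 1/6 * \<bar>\<Sum>i=1..N. sin (of_nat i * (2 * pi * t)) / of_nat i\<bar>"
    by (simp only: norm_mult norm_of_real cmod_character) (simp add: norm_divide)
  then show ?thesis using sum_sin_over_k_bounded[of "2 * pi * t" N] by linarith
qed

definition window_coeff :: "nat \<Rightarrow> int \<Rightarrow> real" where
  "window_coeff N n = of_bool (n = 0) + hilbert_kernel N n"

definition window_supp :: "nat \<Rightarrow> int set" where
  "window_supp N = insert 0 (hilbert_supp N)"

text \<open>The Fourier coefficients of \<open>|1 + q\<^sub>N|\<^sup>2\<close>.\<close>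

definition window_corr :: "nat \<Rightarrow> int \<Rightarrow> real" where
  "window_corr N k = (\<Sum>n\<in>window_supp N. window_coeff N n * window_coeff N (n - k))"

lemma finite_window_supp [simp]: "finite (window_supp N)"
  by (simp add: window_supp_def)

lemma window_coeff_outside: "n \<notin> window_supp N \<Longrightarrow> window_coeff N n = 0"
  by (auto simp: window_coeff_def window_supp_def hilbert_kernel_outside)

text \<open>The squared \<open>L\<^sup>2\<close> norm of \<open>q\<^sub>N\<close> is at most the square of its supremum.\<close>

lemma sum_hilbert_kernel_square_le: "(\<Sum>n\<in>hilbert_supp N. (hilbert_kernel N n)\<^sup>2) \<le> 1/4"
proof -
  let ?p = "\<lambda>t. \<Sum>n\<in>hilbert_supp N. of_real (hilbert_kernel N n) * character (- n) t"
  have "character (- n) t = character n (- t)" for n t by (simp add: character_def)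
  then have b: "cmod (?p t) \<le> 1/2" for t using hilbert_kernel_symbol_bound[of N "- t"] by simp
  have "(\<Sum>n\<in>hilbert_supp N. (hilbert_kernel N n)\<^sup>2) = (LINT t|unit_cell. (cmod (?p t))\<^sup>2)"
    by (subst integral_cmod_square_trig_sum) auto
  also have "\<dots> \<le> (LINT t|unit_cell. 1/4)"
  proof (rule integral_mono)
    have le: "(cmod (?p t))\<^sup>2 \<le> 1/4" for t
      using power_mono[OF b[of t], of 2] by (simp add: power2_eq_square)
    then show "(cmod (?p t))\<^sup>2 \<le> 1/4" for t .
    show "integrable unit_cell (\<lambda>t. (cmod (?p t))\<^sup>2)"
      by (rule finite_measure.integrable_const_bound[OF finite_measure_unit_cell, of _ "1/4"]) (use le in auto)
    show "integrable unit_cell (\<lambda>t. 1/4 :: real)"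
      by (rule finite_measure.integrable_const[OF finite_measure_unit_cell])
  qed
  also have "\<dots> = 1/4" by (simp add: measure_def)
  finally show ?thesis .
qed

lemma sum_window_coeff_square_le: "(\<Sum>n\<in>window_supp N. (window_coeff N n)\<^sup>2) \<le> 3"
proof -
  have "(\<Sum>n\<in>window_supp N. (window_coeff N n)\<^sup>2)
      \<le> (\<Sum>n\<in>window_supp N. 2 * of_bool (n = 0) + 2 * (hilbert_kernel N n)\<^sup>2)"
  proof (rule sum_mono)
    fix n
    have "(x + y)\<^sup>2 \<le> 2 * x\<^sup>2 + 2 * y\<^sup>2" for x y :: real
      using zero_le_power2[of "x - y"] by (simp add: power2_eq_square algebra_simps)
    from this[of "of_bool (n = 0)" "hilbert_kernel N n"]
    show "(window_coeff N n)\<^sup>2 \<le> 2 * of_bool (n = 0) + 2 * (hilbert_kernel N n)\<^sup>2"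
      by (simp add: window_coeff_def of_bool_def split: if_splits)
  qed
  also have "\<dots> = 2 * (\<Sum>n\<in>window_supp N. of_bool (n = 0)) + 2 * (\<Sum>n\<in>window_supp N. (hilbert_kernel N n)\<^sup>2)"
    by (simp add: sum.distrib sum_distrib_left)
  also have "(\<Sum>n\<in>window_supp N. of_bool (n = 0) :: real) = 1"
    by (subst sum.mono_neutral_right[where S = "{0}"]) (auto simp: window_supp_def)
  also have "(\<Sum>n\<in>window_supp N. (hilbert_kernel N n)\<^sup>2) = (\<Sum>n\<in>hilbert_supp N. (hilbert_kernel N n)\<^sup>2)"
    by (rule sum.mono_neutral_right) (auto simp: window_supp_def hilbert_kernel_outside)
  finally show ?thesis using sum_hilbert_kernel_square_le[of N] by linarith
qed

lemma abs_window_corr_le: "\<bar>window_corr N k\<bar> \<le> 3"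
proof -
  let ?c = "window_coeff N" and ?C = "window_supp N"
  have shift: "(\<Sum>n\<in>?C. (?c (n - k))\<^sup>2) \<le> 3"
  proof -
    have "(\<Sum>n\<in>?C. (?c (n - k))\<^sup>2) = (\<Sum>m\<in>(\<lambda>n. n - k) ` ?C. (?c m)\<^sup>2)"
      by (subst sum.reindex) (auto simp: inj_on_def)
    also have "\<dots> \<le> (\<Sum>m\<in>?C \<union> (\<lambda>n. n - k) ` ?C. (?c m)\<^sup>2)" by (rule sum_mono2) auto
    also have "\<dots> = (\<Sum>m\<in>?C. (?c m)\<^sup>2)"
      by (rule sum.mono_neutral_right) (auto simp: window_coeff_outside)
    finally show ?thesis using sum_window_coeff_square_le[of N] by linarith
  qed
  have "\<bar>window_corr N k\<bar> \<le> (\<Sum>n\<in>?C. \<bar>?c n * ?c (n - k)\<bar>)"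
    unfolding window_corr_def by (rule sum_abs)
  also have "\<dots> \<le> (\<Sum>n\<in>?C. ((?c n)\<^sup>2 + (?c (n - k))\<^sup>2) / 2)"
  proof (rule sum_mono)
    fix n
    have "2 * (\<bar>x\<bar> * \<bar>y\<bar>) \<le> x\<^sup>2 + y\<^sup>2" for x y :: real
      using zero_le_power2[of "\<bar>x\<bar> - \<bar>y\<bar>"] by (simp add: power2_eq_square algebra_simps)
    from this[of "?c n" "?c (n - k)"]
    show "\<bar>?c n * ?c (n - k)\<bar> \<le> ((?c n)\<^sup>2 + (?c (n - k))\<^sup>2) / 2" by (simp add: abs_mult)
  qed
  also have "\<dots> = ((\<Sum>n\<in>?C. (?c n)\<^sup>2) + (\<Sum>n\<in>?C. (?c (n - k))\<^sup>2)) / 2"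
    by (simp add: sum_divide_distrib[symmetric] sum.distrib)
  also have "\<dots> \<le> (3 + 3) / 2"
    using add_mono[OF sum_window_coeff_square_le[of N] shift] by (rule divide_right_mono) simp
  finally show ?thesis by simp
qed

text \<open>The support of \<open>q\<^sub>N\<close> lies between \<open>3N\<close> and \<open>5N\<close>, so that the autocorrelation of \<open>q\<^sub>N\<close> vanishes beyond \<open>2N\<close>. At
  the frequencies considered here only the products with the coefficient 1 at the origin remain.\<close>

lemma window_corr_high_frequency:
  assumes N: "0 < N" and k: "3 * int N \<le> k" "k \<le> 4 * int N"
  shows "window_corr N k = hilbert_kernel N k" and "window_corr N (- k) = hilbert_kernel N k"
proof -
  have out: "hilbert_kernel N m = 0" if "m < 3 * int N \<or> 5 * int N < m" for m
    using that by (intro hilbert_kernel_outside) (auto simp: hilbert_supp_def)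
  have kS: "k \<in> window_supp N" using k by (auto simp: window_supp_def hilbert_supp_def)
  have "window_coeff N n * window_coeff N (n - k) = (if n = k then hilbert_kernel N k else 0)"
    if "n \<in> window_supp N" for n
  proof -
    from that consider "n = 0" | "3 * int N \<le> n" "n \<le> 5 * int N"
      by (auto simp: window_supp_def hilbert_supp_def)
    then show ?thesis
    proof cases
      case 1
      then show ?thesis using N k by (simp add: window_coeff_def out)
    next
      case 2
      then show ?thesis using N k by (auto simp: window_coeff_def out)
    qed
  qed
  then have "window_corr N k = (\<Sum>n\<in>window_supp N. if n = k then hilbert_kernel N k else 0)"
    unfolding window_corr_def by (rule sum.cong[OF refl])
  then show "window_corr N k = hilbert_kernel N k" using kS by simp
  have "window_coeff N n * window_coeff N (n - (- k)) = (if n = 0 then hilbert_kernel N k else 0)"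
    if "n \<in> window_supp N" for n
  proof -
    from that consider "n = 0" | "3 * int N \<le> n" "n \<le> 5 * int N"
      by (auto simp: window_supp_def hilbert_supp_def)
    then show ?thesis
    proof cases
      case 1
      then show ?thesis using N k by (simp add: window_coeff_def out)
    next
      case 2
      then show ?thesis using N k by (auto simp: window_coeff_def out)
    qed
  qed
  then have "window_corr N (- k) = (\<Sum>n\<in>window_supp N. if n = 0 then hilbert_kernel N k else 0)"
    unfolding window_corr_def by (rule sum.cong[OF refl])
  then show "window_corr N (- k) = hilbert_kernel N k" by (simp add: window_supp_def)
qed

text \<open>Twice the largest frequency \<open>4N\<close> that matters, plus 1: then the Fejer weights up to this frequency are at least \<open>1/2\<close>, and
  the length is positive for \<open>N = 0\<close>.\<close>

definition block_length :: "nat \<Rightarrow> int" where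
  "block_length N = 8 * int N + 1"

text \<open>The normalized autocorrelation of a block, that is, the Fejer weight \<open>max 0 (1 - |k| / R)\<close> for the block length \<open>R\<close>.\<close>

definition block_corr :: "nat \<Rightarrow> int \<Rightarrow> real" where
  "block_corr N k = (\<Sum>n\<in>{0..<block_length N}. of_bool (n - k \<in> {0..<block_length N})) / of_int (block_length N)"

lemma block_length_pos: "0 < block_length N"
  by (simp add: block_length_def)

lemma block_corr_bounds: "0 \<le> block_corr N k" "block_corr N k \<le> 1"
proof -
  let ?R = "block_length N"
  show "0 \<le> block_corr N k"
    unfolding block_corr_def using block_length_pos[of N] by (intro divide_nonneg_pos sum_nonneg) auto
  have "(\<Sum>n\<in>{0..<?R}. of_bool (n - k \<in> {0..<?R})) \<le> (\<Sum>n\<in>{0..<?R}. 1 :: real)"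
    by (rule sum_mono) simp
  then show "block_corr N k \<le> 1"
    unfolding block_corr_def using block_length_pos[of N] by (simp add: divide_le_eq_1)
qed

lemma block_corr_ge_half:
  assumes "\<bar>k\<bar> \<le> 4 * int N"
  shows "1/2 \<le> block_corr N k"
proof -
  let ?R = "block_length N"
  have "{n \<in> {0..<?R}. n - k \<in> {0..<?R}} = {max 0 k..<min ?R (?R + k)}" by auto
  then have "(\<Sum>n\<in>{0..<?R}. of_bool (n - k \<in> {0..<?R}) :: real) = real (card {max 0 k..<min ?R (?R + k)})"
    by (simp add: sum_of_bool_eq Int_def)
  also have "\<dots> = of_int (?R - \<bar>k\<bar>)" using assms by (auto simp: block_length_def)
  finally have "block_corr N k = of_int (?R - \<bar>k\<bar>) / of_int ?R" by (simp add: block_corr_def)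
  moreover have "?R \<le> 2 * (?R - \<bar>k\<bar>)" using assms by (simp add: block_length_def)
  then have "real_of_int ?R \<le> 2 * of_int (?R - \<bar>k\<bar>)" by linarith
  ultimately show ?thesis using block_length_pos[of N] by (simp only:) (subst pos_le_divide_eq; simp)
qed

text \<open>The contribution of a cell with number \<open>N\<close> to the \<open>K\<close>-th symmetric partial sum, for a test function of unit mass
  on that cell.\<close>

definition block_partial_sum :: "nat \<Rightarrow> nat \<Rightarrow> real" where
  "block_partial_sum N K = (\<Sum>k=- int K..int K. block_corr N k * window_corr N k)"

lemma abs_block_corr_mult_window_corr_le: "\<bar>block_corr N k * window_corr N k\<bar> \<le> 3"
proof -
  have "\<bar>block_corr N k\<bar> * \<bar>window_corr N k\<bar> \<le> 1 * 3"
    using block_corr_bounds[of N k] abs_window_corr_le[of N k] by (intro mult_mono) auto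
  then show ?thesis by (simp add: abs_mult)
qed

lemma abs_block_partial_sum_le: "\<bar>block_partial_sum N K\<bar> \<le> 3 * (2 * real K + 1)"
proof -
  have "\<bar>block_partial_sum N K\<bar> \<le> (\<Sum>k=- int K..int K. \<bar>block_corr N k * window_corr N k\<bar>)"
    unfolding block_partial_sum_def by (rule sum_abs)
  also have "\<dots> \<le> (\<Sum>k=- int K..int K. 3)" by (intro sum_mono abs_block_corr_mult_window_corr_le)
  finally show ?thesis by (simp add: algebra_simps)
qed

text \<open>Between the orders \<open>3N - 1\<close> and \<open>4N\<close> only the coefficients \<open>1/(12 i)\<close> of \<open>q\<^sub>N\<close> are added, at the frequencies
  \<open>4N - i\<close> and their negatives, with weights of at least \<open>1/2\<close>.\<close>

lemma block_partial_sum_jump: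
  assumes N: "0 < N"
  shows "harm N / 12 \<le> block_partial_sum N (4 * N) - block_partial_sum N (3 * N - 1)"
proof -
  let ?t = "\<lambda>k. block_corr N k * window_corr N k"
  let ?H = "{3 * int N..4 * int N}"
  have sets: "{- int (4 * N)..int (4 * N)} = {- int (3 * N - 1)..int (3 * N - 1)} \<union> (?H \<union> uminus ` ?H)"
  proof -
    have "uminus ` ?H = {- (4 * int N)..- (3 * int N)}" by simp
    then show ?thesis using N by (auto simp: of_nat_diff)
  qed
  have "block_partial_sum N (4 * N) = block_partial_sum N (3 * N - 1) + (\<Sum>k\<in>?H \<union> uminus ` ?H. ?t k)"
    unfolding block_partial_sum_def sets using N by (intro sum.union_disjoint) (auto simp: of_nat_diff)
  also have "(\<Sum>k\<in>?H \<union> uminus ` ?H. ?t k) = (\<Sum>k\<in>?H. ?t k) + (\<Sum>k\<in>uminus ` ?H. ?t k)"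
    using N by (intro sum.union_disjoint) auto
  also have "(\<Sum>k\<in>uminus ` ?H. ?t k) = (\<Sum>k\<in>?H. ?t (- k))"
    by (subst sum.reindex) (simp_all add: inj_on_def)
  finally have "block_partial_sum N (4 * N) - block_partial_sum N (3 * N - 1) = (\<Sum>k\<in>?H. ?t k + ?t (- k))"
    by (simp add: sum.distrib)
  moreover have "(\<Sum>k\<in>?H. hilbert_kernel N k) \<le> (\<Sum>k\<in>?H. ?t k + ?t (- k))"
  proof (rule sum_mono)
    fix k assume k: "k \<in> ?H"
    have q: "0 \<le> hilbert_kernel N k" using k by (auto simp: hilbert_kernel_def)
    have "1/2 * hilbert_kernel N k \<le> block_corr N k * hilbert_kernel N k"
      "1/2 * hilbert_kernel N k \<le> block_corr N (- k) * hilbert_kernel N k"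
      by (rule mult_right_mono[OF block_corr_ge_half q], use k in simp)+
    then show "hilbert_kernel N k \<le> ?t k + ?t (- k)"
      using window_corr_high_frequency[OF N, of k] k by simp
  qed
  moreover have "(\<Sum>k\<in>(\<lambda>i. 4 * int N - int i) ` {1..N}. hilbert_kernel N k) \<le> (\<Sum>k\<in>?H. hilbert_kernel N k)"
    by (rule sum_mono2) (auto simp: hilbert_kernel_def)
  moreover have "(\<Sum>k\<in>(\<lambda>i. 4 * int N - int i) ` {1..N}. hilbert_kernel N k) = (\<Sum>i=1..N. inverse (real i) / 12)"
    by (subst sum.reindex) (auto simp: inj_on_def hilbert_kernel_def field_simps intro!: sum.cong)
  moreover have "(\<Sum>i=1..N. inverse (real i) / 12) = harm N / 12" by (simp add: harm_def sum_divide_distrib)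
  ultimately show ?thesis by linarith
qed

lemma block_partial_sum_unbounded: "\<exists>N K. T < \<bar>block_partial_sum N K\<bar>"
proof (rule ccontr)
  assume "\<not> ?thesis"
  then have le: "\<bar>block_partial_sum N K\<bar> \<le> T" for N K by (auto simp: not_less)
  have "filterlim (harm :: nat \<Rightarrow> real) at_top sequentially" by (rule harm_at_top)
  then have "eventually (\<lambda>N. 24 * T < harm N \<and> 0 < N) sequentially"
    by (intro eventually_conj) (auto simp: filterlim_at_top_dense eventually_gt_at_top)
  then obtain N where N: "24 * T < harm N" "0 < N" by (auto simp: eventually_sequentially)
  show False using block_partial_sum_jump[OF N(2)] le[of N "4 * N"] le[of N "3 * N - 1"] N(1) by linarith
qed

section \<open>Gliding hump\<close>

text \<open>Read \<open>S (\<cdot>) K\<close> as a bounded linear functional on absolutely summable sequences, with norm the supremum of \<open>|S j K|\<close> over \<open>j\<close>. If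
  these norms are unbounded, then so are the values at some single nonnegative sequence. The proof chooses orders \<open>K n\<close> and indices \<open>j n\<close> for which
  \<open>|S (j n) (K n)|\<close> exceeds a multiple of \<open>n 5\<^sup>n\<close> and is at least three quarters of the norm. The weight \<open>u n\<close> is either 0 or \<open>5\<^sup>-\<^sup>n\<close>: one of
  the two choices makes the \<open>n\<close>-th partial value at order \<open>K n\<close> large, because the two results
  differ by \<open>5\<^sup>-\<^sup>n |S (j n) (K n)|\<close>, and the later weights are too small to cancel this value.\<close>

lemma gliding_hump:
  fixes S :: "nat \<Rightarrow> nat \<Rightarrow> real"
  assumes bdd: "\<And>j K. \<bar>S j K\<bar> \<le> A K"
    and unbdd: "\<And>T. \<exists>j K. T < \<bar>S j K\<bar>"
  obtains u :: "nat \<Rightarrow> real" and j :: "nat \<Rightarrow> nat"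
  where "\<And>n. 0 \<le> u n" "summable u" "\<not> Bseq (\<lambda>K. \<Sum>n. u n * S (j n) K)"
proof -
  \<comment> \<open>The factor 6 compensates for the loss \<open>1/2 - 1/3 = 1/6\<close> in the final estimate.\<close>
  have "\<exists>j K. 6 * real (Suc n) * 5 ^ n < \<bar>S j K\<bar> \<and> (\<forall>i. 3 * \<bar>S i K\<bar> \<le> 4 * \<bar>S j K\<bar>)" for n :: nat
  proof -
    obtain j0 K where jK: "8 * real (Suc n) * 5 ^ n < \<bar>S j0 K\<bar>" using unbdd by blast
    define s where "s = (SUP i. \<bar>S i K\<bar>)"
    have ba: "bdd_above (range (\<lambda>i. \<bar>S i K\<bar>))" using bdd by (auto intro!: bdd_aboveI)
    have le: "\<bar>S i K\<bar> \<le> s" for i unfolding s_def by (rule cSUP_upper[OF _ ba]) auto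
    have pos: "0 < 8 * real (Suc n) * 5 ^ n" by simp
    have s0: "8 * real (Suc n) * 5 ^ n < s" using jK le[of j0] by linarith
    then have "3 / 4 * s < s" using pos by linarith
    then obtain j where j: "3 / 4 * s < \<bar>S j K\<bar>"
      unfolding s_def using less_cSUP_iff[OF _ ba] by blast
    show ?thesis
    proof (intro exI conjI allI)
      show "6 * real (Suc n) * 5 ^ n < \<bar>S j K\<bar>" using s0 j by linarith
      show "3 * \<bar>S i K\<bar> \<le> 4 * \<bar>S j K\<bar>" for i using j le[of i] by linarith
    qed
  qed
  then obtain j K where big: "\<And>n. 6 * real (Suc n) * 5 ^ n < \<bar>S (j n) (K n)\<bar>"
    and near: "\<And>n i. 3 * \<bar>S i (K n)\<bar> \<le> 4 * \<bar>S (j n) (K n)\<bar>" by metis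
  \<comment> \<open>\<open>V n\<close> collects the contributions of the weights before \<open>n\<close>, and \<open>F\<close> decides on the weight \<open>n\<close>.\<close>
  define F where "F n v = (if \<bar>v (K n)\<bar> \<ge> \<bar>S (j n) (K n)\<bar> / (2 * 5 ^ n) then 0 else 1 / 5 ^ n :: real)" for n and v :: "nat \<Rightarrow> real"
  define V where "V = rec_nat (\<lambda>_. 0) (\<lambda>n v k. v k + F n v * S (j n) k)"
  have V0: "V 0 = (\<lambda>_. 0)" and VS: "\<And>n. V (Suc n) = (\<lambda>k. V n k + F n (V n) * S (j n) k)"
    by (auto simp: V_def)
  define u where "u n = F n (V n)" for n
  have u: "0 \<le> u n" "u n \<le> (1/5) ^ n" for n
    by (auto simp: u_def F_def power_divide)
  have geo: "summable (\<lambda>n. (1/5::real) ^ n)" by simp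
  have su: "summable u"
    by (rule summable_comparison_test'[OF geo, of 0]) (use u in auto)
  have V: "V n k = (\<Sum>i<n. u i * S (j i) k)" for n k
    by (induction n) (auto simp: V0 VS u_def)
  have half: "\<bar>V (Suc n) (K n)\<bar> \<ge> \<bar>S (j n) (K n)\<bar> / (2 * 5 ^ n)" for n
  proof (cases "\<bar>V n (K n)\<bar> \<ge> \<bar>S (j n) (K n)\<bar> / (2 * 5 ^ n)")
    case False
    then have "V (Suc n) (K n) = V n (K n) + S (j n) (K n) / 5 ^ n" by (simp add: VS F_def)
    moreover have "\<bar>S (j n) (K n) / 5 ^ n\<bar> = 2 * (\<bar>S (j n) (K n)\<bar> / (2 * 5 ^ n))" by (simp add: abs_divide)
    ultimately show ?thesis using False by linarith
  qed (simp add: VS F_def)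
  have large: "real (Suc n) \<le> \<bar>\<Sum>i. u i * S (j i) (K n)\<bar>" for n
  proof -
    let ?s = "\<bar>S (j n) (K n)\<bar>"
    let ?t = "\<lambda>i. u i * S (j i) (K n)"
    let ?b = "\<lambda>i. 4 / 3 * ?s * (1/5) ^ i"
    have tb: "\<bar>?t i\<bar> \<le> ?b i" for i
    proof -
      have "\<bar>?t i\<bar> = u i * \<bar>S (j i) (K n)\<bar>" using u(1) by (simp add: abs_mult)
      also have "\<dots> \<le> (1/5) ^ i * (4 / 3 * ?s)"
        using u near[of "j i" n] by (intro mult_mono) auto
      finally show ?thesis by (simp add: mult.commute)
    qed
    have sb: "summable ?b" by (intro summable_mult geo)
    have st: "summable ?t" by (rule summable_comparison_test'[OF sb, of 0]) (use tb in auto)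
    have tail: "\<bar>\<Sum>i. ?t (i + Suc n)\<bar> \<le> ?s / (3 * 5 ^ n)"
    proof -
      have "norm (\<Sum>i. ?t (i + Suc n)) \<le> (\<Sum>i. ?b (i + Suc n))"
      proof (rule norm_suminf_le)
        show "norm (?t (i + Suc n)) \<le> ?b (i + Suc n)" for i unfolding real_norm_def by (rule tb)
        show "summable (\<lambda>i. ?b (i + Suc n))" by (rule summable_ignore_initial_segment[OF sb])
      qed
      also have "(\<lambda>i. ?b (i + Suc n)) = (\<lambda>i. (4 / 3 * ?s * (1/5) ^ Suc n) * (1/5) ^ i)"
        by (auto simp: power_add)
      also have "suminf \<dots> = (4 / 3 * ?s * (1/5) ^ Suc n) * (1 / (1 - 1/5))"
        by (subst suminf_mult[OF geo]) (simp add: suminf_geometric)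
      also have "\<dots> = ?s / (3 * 5 ^ n)" by (simp add: power_divide)
      finally show ?thesis by simp
    qed
    have "(\<Sum>i. ?t i) = (\<Sum>i. ?t (i + Suc n)) + V (Suc n) (K n)"
      unfolding V by (rule suminf_split_initial_segment[OF st])
    then have "\<bar>\<Sum>i. ?t i\<bar> \<ge> ?s / (2 * 5 ^ n) - ?s / (3 * 5 ^ n)"
      using half[of n] tail by linarith
    moreover have "?s / (2 * 5 ^ n) - ?s / (3 * 5 ^ n) = ?s / (6 * 5 ^ n)" by (simp add: field_simps)
    moreover have "real (Suc n) \<le> ?s / (6 * 5 ^ n)" using big[of n] by (simp add: field_simps)
    ultimately show ?thesis by linarith
  qed
  show ?thesis
  proof (rule that[of u j])
    show "\<not> Bseq (\<lambda>K. \<Sum>n. u n * S (j n) K)"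
    proof
      assume "Bseq (\<lambda>K. \<Sum>n. u n * S (j n) K)"
      then obtain B where B: "\<And>K. norm (\<Sum>n. u n * S (j n) K) \<le> B" by (auto simp: Bseq_def)
      obtain n where "B < real n" using reals_Archimedean2 by blast
      then show False using large[of n] B[of "K n"] by simp
    qed
  qed (use u su in auto)
qed

section \<open>Failure of the identity\<close>

definition window :: "(nat \<Rightarrow> nat) \<Rightarrow> real \<Rightarrow> complex" where
  "window j = cell_fun (\<lambda>i n. of_real (window_coeff (j i) n))"

text \<open>The height for which the block on the \<open>i\<close>-th cells contributes mass \<open>u i\<close> to the squared norm of the test function.\<close>

definition block_height :: "(nat \<Rightarrow> nat) \<Rightarrow> (nat \<Rightarrow> real) \<Rightarrow> nat \<Rightarrow> real" where
  "block_height j u i = sqrt (u i / (cell_width i * of_int (block_length (j i))))"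

definition test_fun :: "(nat \<Rightarrow> nat) \<Rightarrow> (nat \<Rightarrow> real) \<Rightarrow> real \<Rightarrow> complex" where
  "test_fun j u = cell_fun (\<lambda>i n. of_real (block_height j u i * of_bool (n \<in> {0..<block_length (j i)})))"

lemma block_height_square:
  assumes "0 \<le> u i"
  shows "cell_width i * (block_height j u i)\<^sup>2 = u i / of_int (block_length (j i))"
proof -
  have "(block_height j u i)\<^sup>2 = u i / (cell_width i * of_int (block_length (j i)))"
    unfolding block_height_def
    using assms cell_width_pos[of i] block_length_pos[of "j i"] by (intro real_sqrt_pow2) simp
  then show ?thesis using cell_width_pos[of i] by simp
qed

lemma window_in_L2: "window j \<in> L2"
  unfolding window_def
proof (rule cell_fun_in_L2[where N = "\<lambda>i. window_supp (j i)"])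
  have "summable (\<lambda>i. cell_width i * 3)"
    using cell_width_sums by (intro summable_mult2) (auto simp: sums_iff)
  then show "summable (\<lambda>i. cell_width i * (\<Sum>n\<in>window_supp (j i). (cmod (of_real (window_coeff (j i) n)))\<^sup>2))"
  proof (rule summable_comparison_test'[where N = 0])
    fix i
    have "(\<Sum>n\<in>window_supp (j i). (cmod (of_real (window_coeff (j i) n)))\<^sup>2) \<le> 3"
      using sum_window_coeff_square_le[of "j i"] by simp
    moreover have "0 \<le> (\<Sum>n\<in>window_supp (j i). (cmod (of_real (window_coeff (j i) n)))\<^sup>2)" by (rule sum_nonneg) simp
    ultimately show "norm (cell_width i * (\<Sum>n\<in>window_supp (j i). (cmod (of_real (window_coeff (j i) n)))\<^sup>2)) \<le> cell_width i * 3"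
      using cell_width_pos[of i] by (simp add: abs_mult del: norm_of_real)
  qed
qed (auto simp: window_coeff_outside)

lemma WH_frame_window: "WH_frame (window j)"
proof -
  have eq: "window j = cell_fun (\<lambda>i n. complex_of_real (of_bool (n = 0) + hilbert_kernel (j i) n))"
    by (simp only: window_def window_coeff_def)
  show ?thesis
    unfolding eq
    by (rule WH_frame_cell_fun[where Q = "\<lambda>i. hilbert_supp (j i)", OF finite_hilbert_supp hilbert_kernel_outside
        hilbert_kernel_symbol_bound window_in_L2[of j, unfolded eq]])
qed

lemma test_fun_in_L2:
  assumes u: "\<And>i. 0 \<le> u i" "summable u"
  shows "test_fun j u \<in> L2"
  unfolding test_fun_def
proof (rule cell_fun_in_L2[where N = "\<lambda>i. {0..<block_length (j i)}"])
  have "cell_width i * (\<Sum>n\<in>{0..<block_length (j i)}.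
      (cmod (of_real (block_height j u i * of_bool (n \<in> {0..<block_length (j i)}))))\<^sup>2) = u i" for i
  proof -
    have "(\<Sum>n\<in>{0..<block_length (j i)}.
        (cmod (of_real (block_height j u i * of_bool (n \<in> {0..<block_length (j i)}))))\<^sup>2)
      = (\<Sum>n\<in>{0..<block_length (j i)}. (block_height j u i)\<^sup>2)"
      by (intro sum.cong refl) simp
    also have "\<dots> = of_int (block_length (j i)) * (block_height j u i)\<^sup>2"
      using block_length_pos[of "j i"] by simp
    also have "cell_width i * \<dots> = of_int (block_length (j i)) * (cell_width i * (block_height j u i)\<^sup>2)"
      by simp
    also have "\<dots> = u i" unfolding block_height_square[OF u(1)] using block_length_pos[of "j i"] by simp
    finally show ?thesis .
  qed
  then show "summable (\<lambda>i. cell_width i * (\<Sum>n\<in>{0..<block_length (j i)}.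
      (cmod (of_real (block_height j u i * of_bool (n \<in> {0..<block_length (j i)}))))\<^sup>2))"
    using u(2) by (simp only:)
qed auto

text \<open>The sum over all integer translates does not depend on the integer part of \<open>t\<close>.\<close>

lemma WH_G_window: "WH_G (window j) k t = of_real (window_corr (j (cell_index t)) k)"
proof -
  let ?i = "cell_index t"
  let ?c = "\<lambda>n. complex_of_real (window_coeff (j ?i) n)"
  have shift: "window j (t - of_int n) = ?c (\<lfloor>t\<rfloor> - n)" for n
    using cell_fun_add_of_int[of "\<lambda>i n. complex_of_real (window_coeff (j i) n)" t "- n"]
    by (simp add: window_def)
  have "window j (t - of_int n - of_int k) = ?c (\<lfloor>t\<rfloor> - n - k)" for n
    using shift[of "n + k"] by (simp add: algebra_simps)
  then have "WH_G (window j) k t = (\<Sum>\<^sub>\<infinity>n. ?c (\<lfloor>t\<rfloor> - n) * ?c (\<lfloor>t\<rfloor> - n - k))"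
    unfolding WH_G_def shift by simp
  also have "\<dots> = (\<Sum>\<^sub>\<infinity>n. ?c n * ?c (n - k))"
  proof (rule infsum_reindex_bij_betw[of "\<lambda>n. \<lfloor>t\<rfloor> - n" UNIV UNIV "\<lambda>n. ?c n * ?c (n - k)"])
    show "bij_betw (\<lambda>n. \<lfloor>t\<rfloor> - n) UNIV UNIV"
      by (rule bij_betw_byWitness[where f' = "\<lambda>n. \<lfloor>t\<rfloor> - n"]) auto
  qed
  also have "\<dots> = (\<Sum>\<^sub>\<infinity>n\<in>window_supp (j ?i). ?c n * ?c (n - k))"
    by (rule infsum_cong_neutral) (auto simp: window_coeff_outside)
  also have "\<dots> = of_real (window_corr (j ?i) k)" by (simp add: window_corr_def)
  finally show ?thesis .
qed

text \<open>Both factors of the integrand are constant on cells, so the integral is the sum of the contributions of the cells; each of them is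
  the product of the mass \<open>u i\<close> and the values at \<open>k\<close> of the two autocorrelations.\<close>

lemma WH_identity_term_window_test_fun:
  assumes u: "\<And>i. 0 \<le> u i" "summable u"
  shows "summable (\<lambda>i. u i * (block_corr (j i) k * window_corr (j i) k))"
    and "WH_identity_term (window j) (test_fun j u) k
      = of_real (\<Sum>i. u i * (block_corr (j i) k * window_corr (j i) k))"
proof -
  let ?I = "\<lambda>i. {0..<block_length (j i)}"
  define v where "v i n = (block_height j u i)\<^sup>2 * (of_bool (n \<in> ?I i) * of_bool (n - k \<in> ?I i)) * window_corr (j i) k" for i n
  have cell_sum: "cell_width i * (\<Sum>n\<in>?I i. (block_height j u i)\<^sup>2 * (of_bool (n \<in> ?I i) * of_bool (n - k \<in> ?I i)) * w)
      = u i * (block_corr (j i) k * w)" for i and w :: real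
  proof -
    have "(\<Sum>n\<in>?I i. (block_height j u i)\<^sup>2 * (of_bool (n \<in> ?I i) * of_bool (n - k \<in> ?I i)) * w)
        = (\<Sum>n\<in>?I i. ((block_height j u i)\<^sup>2 * w) * of_bool (n - k \<in> ?I i))"
      by (intro sum.cong refl) simp
    also have "\<dots> = ((block_height j u i)\<^sup>2 * w) * (of_int (block_length (j i)) * block_corr (j i) k)"
      unfolding sum_distrib_left[symmetric] block_corr_def using block_length_pos[of "j i"] by simp
    also have "cell_width i * \<dots> = (cell_width i * (block_height j u i)\<^sup>2) * of_int (block_length (j i)) * (block_corr (j i) k * w)"
      by simp
    also have "\<dots> = u i * (block_corr (j i) k * w)"
      unfolding block_height_square[OF u(1)] using block_length_pos[of "j i"] by simp
    finally show ?thesis .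
  qed
  have bound: "\<bar>u i * (block_corr (j i) k * w)\<bar> \<le> u i * 3" if "\<bar>w\<bar> \<le> 3" for i w
  proof -
    have "\<bar>block_corr (j i) k\<bar> * \<bar>w\<bar> \<le> 1 * 3"
      using block_corr_bounds[of "j i" k] that by (intro mult_mono) auto
    then show ?thesis using u(1)[of i] by (simp add: abs_mult mult_left_mono)
  qed
  have su3: "summable (\<lambda>i. u i * 3)" by (rule summable_mult2[OF u(2)])
  show "summable (\<lambda>i. u i * (block_corr (j i) k * window_corr (j i) k))"
    by (rule summable_comparison_test'[OF su3, of 0]) (use bound[OF abs_window_corr_le] in simp)
  have abs_v: "norm (v i n) = (block_height j u i)\<^sup>2 * (of_bool (n \<in> ?I i) * of_bool (n - k \<in> ?I i)) * \<bar>window_corr (j i) k\<bar>" for i n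
    by (simp add: v_def abs_mult)
  have "summable (\<lambda>i. cell_width i * (\<Sum>n\<in>?I i. norm (v i n)))"
    unfolding abs_v cell_sum
    by (rule summable_comparison_test'[OF su3, of 0]) (use bound[of "\<bar>window_corr (j _) k\<bar>"] abs_window_corr_le in simp)
  then have int: "(LINT x|lborel. cell_fun v x) = (\<Sum>i. cell_width i *\<^sub>R (\<Sum>n\<in>?I i. v i n))"
    by (intro integral_cell_fun(2)) (auto simp: v_def)
  have "WH_identity_term (window j) (test_fun j u) k = (LINT x|lborel. complex_of_real (cell_fun v x))"
    unfolding WH_identity_term_def
  proof (rule Bochner_Integration.integral_cong)
    fix t
    let ?i = "cell_index t"
    have "test_fun j u (t - of_int k) = of_real (block_height j u ?i * of_bool (\<lfloor>t\<rfloor> - k \<in> ?I ?i))"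
      using cell_fun_add_of_int[of "\<lambda>i n. complex_of_real (block_height j u i * of_bool (n \<in> ?I i))" t "- k"]
      by (simp add: test_fun_def)
    moreover have "test_fun j u t = of_real (block_height j u ?i * of_bool (\<lfloor>t\<rfloor> \<in> ?I ?i))"
      by (simp add: test_fun_def cell_fun_def)
    ultimately show "cnj (test_fun j u t) * test_fun j u (t - of_int k) * WH_G (window j) k t = complex_of_real (cell_fun v t)"
      unfolding WH_G_window cell_fun_def v_def
      by (simp only: complex_cnj_complex_of_real of_real_mult[symmetric]) (simp add: power2_eq_square mult_ac)
  qed simp
  also have "\<dots> = of_real (LINT x|lborel. cell_fun v x)" by (rule integral_complex_of_real)
  also have "(LINT x|lborel. cell_fun v x) = (\<Sum>i. u i * (block_corr (j i) k * window_corr (j i) k))"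
    unfolding int unfolding v_def real_scaleR_def cell_sum ..
  finally show "WH_identity_term (window j) (test_fun j u) k
      = of_real (\<Sum>i. u i * (block_corr (j i) k * window_corr (j i) k))" .
qed

theorem corollary5p6:
  "\<exists>g\<in>L2. WH_frame g \<and>
     (\<exists>f\<in>L2. \<not> convergent (\<lambda>K::nat. \<Sum>k = - int K..int K. WH_identity_term g f k))"
proof -
  obtain u j where u: "\<And>n. 0 \<le> u n" "summable u"
    and unbounded: "\<not> Bseq (\<lambda>K. \<Sum>n. u n * block_partial_sum (j n) K)"
    by (rule gliding_hump[of block_partial_sum "\<lambda>K. 3 * (2 * real K + 1)"])
      (use abs_block_partial_sum_le block_partial_sum_unbounded in auto)
  have partial: "(\<Sum>k = - int K..int K. WH_identity_term (window j) (test_fun j u) k)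
      = of_real (\<Sum>n. u n * block_partial_sum (j n) K)" for K
  proof -
    have "(\<Sum>k = - int K..int K. WH_identity_term (window j) (test_fun j u) k)
        = of_real (\<Sum>k = - int K..int K. \<Sum>n. u n * (block_corr (j n) k * window_corr (j n) k))"
      unfolding of_real_sum by (intro sum.cong refl WH_identity_term_window_test_fun(2) u)
    also have "(\<Sum>k = - int K..int K. \<Sum>n. u n * (block_corr (j n) k * window_corr (j n) k))
        = (\<Sum>n. \<Sum>k = - int K..int K. u n * (block_corr (j n) k * window_corr (j n) k))"
      by (rule suminf_sum[symmetric]) (rule WH_identity_term_window_test_fun(1)[OF u])
    also have "\<dots> = (\<Sum>n. u n * block_partial_sum (j n) K)"
      by (simp only: block_partial_sum_def sum_distrib_left)
    finally show ?thesis .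
  qed
  have "\<not> convergent (\<lambda>K::nat. \<Sum>k = - int K..int K. WH_identity_term (window j) (test_fun j u) k)"
  proof
    assume "convergent (\<lambda>K::nat. \<Sum>k = - int K..int K. WH_identity_term (window j) (test_fun j u) k)"
    then have "Bseq (\<lambda>K. complex_of_real (\<Sum>n. u n * block_partial_sum (j n) K))"
      unfolding partial by (rule convergent_imp_Bseq)
    then show False using unbounded by (simp add: Bseq_def)
  qed
  then show ?thesis using window_in_L2 WH_frame_window test_fun_in_L2[OF u] by blast
qed

end
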